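(* Let $(Y_n)_{n\in\mathbb N_0}$ be a Markov process with state space $E\subseteq\mathbb R$, let $0<\rho\le1$ and $g:\mathbb R\to[0,\infty)$, and let $V,\tau_y,\phi,f$ be as defined in the context. Assume that for every $y\in E$ one has $E_y\sup_n\rho^ng(Y_n)<\infty$ and $\rho^ng(Y_n)\to0$ $P_y$-a.s. as $n\to\infty$, and, in case $\rho=1$, that $P_y(\tau_y=\infty)>0$ for all $y\in E$. Let $$\alpha^*=\inf\{z\in E:g(z)\ge\phi(z)\},$$ where $\alpha^*\in E$, and assume that $f$ is increasing (non-decreasing) on $\{y\in E:y\ge\alpha^*\}$. (i) If $f(\alpha^* )\ge0$, then $\tau^*=\inf\{n\ge0:Y_n\ge\alpha^*\}$ is an optimal stopping time, i.e. $E_y\rho^{\tau^*}g(Y_{\tau^*})=V(y)$ for all $y\in E$ (so the optimal threshold is $\alpha^*$). (ii) If $f(\alpha^* )\le0$, then $\tau^*=\inf\{n\ge0:Y_n>\alpha^*\}$ is an optimal stopping time, i.e. $E_y\rho^{\tau^*}g(Y_{\tau^*})=V(y)$ for all $y\in E$.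
   Context: Setting: $(Y_n)_{n\in\mathbb N_0}$ is a (time-homogeneous) Markov process with respect to a filtration $(\mathcal A_n)_{n\in\mathbb N_0}$, with state space $E\subseteq\mathbb R$; under $P_y$ it starts at $Y_0=y$, and $E_y$ is the corresponding expectation. $g$ is measurable. Stopping times may take the value $+\infty$; conventions: $Y_\infty=\Delta$ for an extra state $\Delta\notin\mathbb R$, $g(\Delta)=0$, $\rho^\infty=0$ (also when $\rho=1$), $\inf\emptyset=\infty$. Value function: $V(y)=\sup_\tau E_y\rho^\tau g(Y_\tau)$, the supremum being over all stopping times $\tau$ with respect to $(\mathcal A_n)$. For $y\in E$: $\tau_y=\inf\{n>0:Y_n>y\}$, $\phi(y)=E_y\rho^{\tau_y}g(Y_{\tau_y})$, and $$f(y)=\frac{1}{1-E_y(\rho^{\tau_y})}\,\bigl(g(y)-\phi(y)\bigr).$$ For $\rho=1$, $1-E_y(\rho^{\tau_y})=P_y(\tau_y=\infty)$. *)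

theory Defs
  imports "HOL-Probability.Probability"
begin

text \<open>
  A time-homogeneous Markov process with respect to the filtration \<open>F\<close>, with state space \<open>E\<close>
  (carrying the trace of the Borel sets), given as a family of laws \<open>P y\<close>, \<open>y \<in> E\<close>, on one
  measurable space. Of \<open>M\<close> only the carrier and the sigma-algebra matter. The values \<open>P y\<close>
  for \<open>y \<notin> E\<close> are irrelevant.
\<close>

definition transition :: "real set \<Rightarrow> (real \<Rightarrow> 'a measure) \<Rightarrow> (nat \<Rightarrow> 'a \<Rightarrow> real) \<Rightarrow> real \<Rightarrow> real measure"
  where "transition E P Y y = distr (P y) (restrict_space borel E) (Y 1)"

locale real_markov_process = filtration "space M" F
  for M :: "'a measure" and F :: "nat \<Rightarrow> 'a measure" +
  fixes E :: "real set" and P :: "real \<Rightarrow> 'a measure" and Y :: "nat \<Rightarrow> 'a \<Rightarrow> real"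
  assumes subalgebra_F: "\<And>n. subalgebra M (F n)"
    and prob_space_P: "\<And>y. y \<in> E \<Longrightarrow> prob_space (P y)"
    and sets_P: "\<And>y. y \<in> E \<Longrightarrow> sets (P y) = sets M"
    and adapted: "\<And>n. Y n \<in> F n \<rightarrow>\<^sub>M restrict_space borel E"
    and start: "\<And>y. y \<in> E \<Longrightarrow> AE \<omega> in P y. Y 0 \<omega> = y"
    and kernel: "transition E P Y \<in> restrict_space borel E \<rightarrow>\<^sub>M prob_algebra (restrict_space borel E)"
    and markov: "\<And>y n B. y \<in> E \<Longrightarrow> B \<in> sets (restrict_space borel E) \<Longrightarrow>
      AE \<omega> in P y. real_cond_exp (P y) (F n) (\<lambda>\<omega>. indicator B (Y (Suc n) \<omega>)) \<omega>
        = measure (transition E P Y (Y n \<omega>)) B"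

text \<open>
  Random times are \<open>enat\<close>-valued. The library's \<^const>\<open>stopping_time\<close> is used with the filtration
  extended by \<open>M\<close> at time \<open>\<infinity>\<close>, where the condition \<open>\<tau> \<le> \<infinity>\<close> holds trivially, so that this
  says \<open>{\<tau> \<le> n} \<in> F n\<close> for all natural \<open>n\<close>.
\<close>

definition stopping_times :: "'a measure \<Rightarrow> (nat \<Rightarrow> 'a measure) \<Rightarrow> ('a \<Rightarrow> enat) set"
  where "stopping_times M F = {\<tau>. stopping_time (case_enat F M) \<tau>}"

text \<open>
  The branches for \<open>\<infinity>\<close> below implement the conventions \<open>\<rho>\<^sup>\<infinity> = 0\<close> (also for \<open>\<rho> = 1\<close>) and
  \<open>g \<Delta> = 0\<close> for the extra state \<open>\<Delta> = Y\<^sub>\<infinity>\<close>.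
\<close>

definition discount :: "real \<Rightarrow> enat \<Rightarrow> real"
  where "discount \<rho> t = (case t of enat n \<Rightarrow> \<rho> ^ n | \<infinity> \<Rightarrow> 0)"

definition stopped_value :: "(real \<Rightarrow> real) \<Rightarrow> (nat \<Rightarrow> 'a \<Rightarrow> real) \<Rightarrow> ('a \<Rightarrow> enat) \<Rightarrow> 'a \<Rightarrow> real"
  where "stopped_value g Y \<tau> \<omega> = (case \<tau> \<omega> of enat n \<Rightarrow> g (Y n \<omega>) | \<infinity> \<Rightarrow> 0)"

definition gain ::
    "(real \<Rightarrow> 'a measure) \<Rightarrow> (nat \<Rightarrow> 'a \<Rightarrow> real) \<Rightarrow> real \<Rightarrow> (real \<Rightarrow> real) \<Rightarrow> ('a \<Rightarrow> enat) \<Rightarrow> real \<Rightarrow> ennreal"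
  where "gain P Y \<rho> g \<tau> y = (\<integral>\<^sup>+\<omega>. ennreal (discount \<rho> (\<tau> \<omega>) * stopped_value g Y \<tau> \<omega>) \<partial>P y)"

definition value_function ::
    "'a measure \<Rightarrow> (nat \<Rightarrow> 'a measure) \<Rightarrow> (real \<Rightarrow> 'a measure) \<Rightarrow> (nat \<Rightarrow> 'a \<Rightarrow> real) \<Rightarrow> real \<Rightarrow> (real \<Rightarrow> real)
      \<Rightarrow> real \<Rightarrow> ennreal"
  where "value_function M F P Y \<rho> g y = (SUP \<tau>\<in>stopping_times M F. gain P Y \<rho> g \<tau> y)"

definition optimal_stopping_time ::
    "'a measure \<Rightarrow> (nat \<Rightarrow> 'a measure) \<Rightarrow> real set \<Rightarrow> (real \<Rightarrow> 'a measure) \<Rightarrow> (nat \<Rightarrow> 'a \<Rightarrow> real) \<Rightarrow> real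
      \<Rightarrow> (real \<Rightarrow> real) \<Rightarrow> ('a \<Rightarrow> enat) \<Rightarrow> bool"
  where "optimal_stopping_time M F E P Y \<rho> g \<tau> \<longleftrightarrow>
    \<tau> \<in> stopping_times M F \<and> (\<forall>y\<in>E. gain P Y \<rho> g \<tau> y = value_function M F P Y \<rho> g y)"

text \<open>In \<^typ>\<open>enat\<close> the infimum of the empty set is \<open>\<infinity>\<close>, as required for the following times.\<close>

definition ladder_time :: "(nat \<Rightarrow> 'a \<Rightarrow> real) \<Rightarrow> real \<Rightarrow> 'a \<Rightarrow> enat"
  where "ladder_time Y y \<omega> = (INF n\<in>{n. 0 < n \<and> y < Y n \<omega>}. enat n)"

definition entry_time :: "(nat \<Rightarrow> 'a \<Rightarrow> real) \<Rightarrow> real set \<Rightarrow> 'a \<Rightarrow> enat"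
  where "entry_time Y B \<omega> = (INF n\<in>{n. Y n \<omega> \<in> B}. enat n)"

text \<open>
  The conversion to a real number loses nothing where \<open>\<rho>\<^sup>n g(Y\<^sub>n)\<close> has a \<open>P y\<close>-integrable supremum,
  since then the gain is finite.
\<close>

definition phi :: "(real \<Rightarrow> 'a measure) \<Rightarrow> (nat \<Rightarrow> 'a \<Rightarrow> real) \<Rightarrow> real \<Rightarrow> (real \<Rightarrow> real) \<Rightarrow> real \<Rightarrow> real"
  where "phi P Y \<rho> g y = enn2real (gain P Y \<rho> g (ladder_time Y y) y)"

definition f_fun :: "(real \<Rightarrow> 'a measure) \<Rightarrow> (nat \<Rightarrow> 'a \<Rightarrow> real) \<Rightarrow> real \<Rightarrow> (real \<Rightarrow> real) \<Rightarrow> real \<Rightarrow> real"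
  where "f_fun P Y \<rho> g y =
    1 / (1 - (\<integral>\<omega>. discount \<rho> (ladder_time Y y \<omega>) \<partial>P y)) * (g y - phi P Y \<rho> g y)"

text \<open>
  The infimum is taken in the extended reals, so that \<open>alpha_star = ereal a\<close> for a real \<open>a\<close> entails
  that the set is nonempty and bounded below.
\<close>

definition alpha_star :: "real set \<Rightarrow> (real \<Rightarrow> 'a measure) \<Rightarrow> (nat \<Rightarrow> 'a \<Rightarrow> real) \<Rightarrow> real \<Rightarrow> (real \<Rightarrow> real) \<Rightarrow> ereal"
  where "alpha_star E P Y \<rho> g = (INF z\<in>{z\<in>E. g z \<ge> phi P Y \<rho> g z}. ereal z)"

end

theory Submission
  imports Defs
begin

text \<open>
  Both cases concern the entry time into an up-set \<open>U\<close> such that \<open>f \<le> 0\<close> on \<open>E - U\<close>, while \<open>f\<close> is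
  non-negative and non-decreasing on \<open>E \<inter> U\<close>; in case (ii) \<open>f\<close> is non-negative above \<open>a\<close> because \<open>a\<close>
  is an infimum of points at which \<open>f \<ge> 0\<close>.

  For a constant \<open>c \<ge> 0\<close>, the inequality \<open>f x \<le> c\<close> says that
  \<open>g x - c \<le> E\<^sub>x \<rho>\<^sup>\<tau> (g Y\<^sub>\<tau> - c)\<close> for the ladder time \<open>\<tau>\<close> of \<open>x\<close>. Iterating it along the successive
  records up to the entry time \<open>\<kappa>\<close> of an up-set gives \<open>g z - c \<le> E\<^sub>z \<rho>\<^sup>\<kappa> (g Y\<^sub>\<kappa> - c)\<close>, where the
  contribution of \<open>g\<close> to the remainder vanishes since \<open>\<rho>\<^sup>n g Y\<^sub>n\<close> tends to \<open>0\<close> and has an integrable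
  supremum, and that of \<open>c\<close> has the right sign.

  Let \<open>W\<close> be the gain of the entry time into \<open>U\<close>. With the up-set \<open>U\<close> and \<open>c = 0\<close> this yields
  \<open>g \<le> W\<close>. With the up-set \<open>{x<..}\<close> and \<open>c = f x\<close>, where \<open>x \<in> U\<close>, it shows that waiting one step at
  \<open>x\<close> does not pay, so \<open>W\<close> is \<open>\<rho>\<close>-excessive and therefore dominates the value function.
\<close>

section \<open>The one-step Markov property\<close>

context real_markov_process
begin

abbreviation S :: "real measure" where "S \<equiv> restrict_space borel E"

abbreviation K :: "real \<Rightarrow> real measure" where "K \<equiv> transition E P Y"

declare adapted [measurable]

lemma space_S: "space S = E"
  by (simp add: space_restrict_space)

lemma measurable_F_mono: "m \<le> n \<Longrightarrow> h \<in> F m \<rightarrow>\<^sub>M N \<Longrightarrow> h \<in> F n \<rightarrow>\<^sub>M N"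
  using sets_F_mono[of m n] by (auto simp: measurable_def space_F)

lemma space_P: "y \<in> E \<Longrightarrow> space (P y) = space M"
  by (rule sets_eq_imp_space_eq[OF sets_P])

lemma subalgebra_P: "y \<in> E \<Longrightarrow> subalgebra (P y) (F n)"
  using subalgebra_F[of n] sets_P[of y] space_P[of y] by (simp add: subalgebra_def)

lemma measurable_F_P: "y \<in> E \<Longrightarrow> h \<in> F n \<rightarrow>\<^sub>M N \<Longrightarrow> h \<in> P y \<rightarrow>\<^sub>M N"
  by (rule measurable_from_subalg[OF subalgebra_P])

lemma Y_in_E: "\<omega> \<in> space M \<Longrightarrow> Y n \<omega> \<in> E"
  using measurable_space[OF adapted, of \<omega> n] by (simp add: space_F space_S)

lemma K_measurable [measurable]: "K \<in> S \<rightarrow>\<^sub>M subprob_algebra S"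
  by (rule measurable_prob_algebraD[OF kernel])

lemma sets_K [measurable_cong]: "sets (K x) = sets S"
  by (simp add: transition_def)

lemma prob_space_K: "x \<in> E \<Longrightarrow> prob_space (K x)"
  using measurable_space[OF kernel, of x] by (simp add: space_S space_prob_algebra)

lemma space_K: "space (K x) = E"
  by (simp add: transition_def space_S)

lemma borel_measurable_K:
  assumes "case_prod h \<in> borel_measurable (N \<Otimes>\<^sub>M S)" "X \<in> N \<rightarrow>\<^sub>M S"
  shows "(\<lambda>\<omega>. \<integral>\<^sup>+x. h \<omega> x \<partial>K (X \<omega>)) \<in> borel_measurable N"
  by (rule nn_integral_measurable_subprob_algebra2[OF assms(1)]) (use assms(2) in measurable)

lemma markov_rectangle:
  assumes y: "y \<in> E" and A: "A \<in> sets (F n)" and B: "B \<in> sets S"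
  shows "emeasure (P y) (A \<inter> {\<omega> \<in> space M. Y (Suc n) \<omega> \<in> B}) =
    (\<integral>\<^sup>+\<omega>. indicator A \<omega> * emeasure (K (Y n \<omega>)) B \<partial>P y)"
proof -
  interpret prob_space "P y" by (rule prob_space_P[OF y])
  interpret finite_measure_subalgebra "P y" "F n"
    by unfold_locales (rule subalgebra_P[OF y])
  note [measurable] = B measurable_F_P[OF y adapted]
  have A' [measurable]: "A \<in> sets (P y)"
    using A subalgebra_P[OF y, of n] by (auto simp: subalgebra_def)
  have m: "(\<lambda>\<omega>. measure (K (Y n \<omega>)) B) \<in> borel_measurable (P y)"
    by measurable
  have bd: "measure (K (Y n \<omega>)) B \<le> 1" if "\<omega> \<in> space (P y)" for \<omega>
    using prob_space.prob_le_1[OF prob_space_K] Y_in_E that space_P[OF y] by blast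
  have int: "integrable (P y) (\<lambda>\<omega>. indicator A \<omega> * measure (K (Y n \<omega>)) B)"
    by (rule integrable_const_bound[where B=1]) (auto intro!: AE_I2 bd simp: indicator_def)
  have "measure (P y) (A \<inter> {\<omega> \<in> space M. Y (Suc n) \<omega> \<in> B}) =
      (\<integral>\<omega>. indicator (A \<inter> {\<omega> \<in> space M. Y (Suc n) \<omega> \<in> B}) \<omega> \<partial>P y)"
    by (simp add: Int_assoc space_P[OF y] inf.absorb1)
  also have "\<dots> = (\<integral>\<omega>\<in>A. indicator B (Y (Suc n) \<omega>) \<partial>P y)"
    unfolding set_lebesgue_integral_def
    by (rule Bochner_Integration.integral_cong) (auto simp: indicator_def space_P[OF y])
  also have "\<dots> = (\<integral>\<omega>\<in>A. real_cond_exp (P y) (F n) (\<lambda>\<omega>. indicator B (Y (Suc n) \<omega>)) \<omega> \<partial>P y)"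
    by (rule real_cond_exp_intA[OF _ A], rule integrable_const_bound[where B=1])
       (auto simp: indicator_def)
  also have "\<dots> = (\<integral>\<omega>. indicator A \<omega> * measure (K (Y n \<omega>)) B \<partial>P y)"
    unfolding set_lebesgue_integral_def
    by (rule integral_cong_AE) (use markov[OF y B, of n] m in auto)
  finally have "emeasure (P y) (A \<inter> {\<omega> \<in> space M. Y (Suc n) \<omega> \<in> B}) =
      ennreal (\<integral>\<omega>. indicator A \<omega> * measure (K (Y n \<omega>)) B \<partial>P y)"
    by (simp add: emeasure_eq_measure)
  also have "\<dots> = (\<integral>\<^sup>+\<omega>. ennreal (indicator A \<omega> * measure (K (Y n \<omega>)) B) \<partial>P y)"
    by (rule nn_integral_eq_integral[symmetric]) (use int in auto)
  also have "\<dots> = (\<integral>\<^sup>+\<omega>. indicator A \<omega> * emeasure (K (Y n \<omega>)) B \<partial>P y)"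
  proof (rule nn_integral_cong)
    fix \<omega> assume "\<omega> \<in> space (P y)"
    then interpret K: prob_space "K (Y n \<omega>)"
      using Y_in_E space_P[OF y] by (intro prob_space_K) auto
    show "ennreal (indicator A \<omega> * measure (K (Y n \<omega>)) B) =
        indicator A \<omega> * emeasure (K (Y n \<omega>)) B"
      by (simp add: K.emeasure_eq_measure indicator_def)
  qed
  finally show ?thesis .
qed

lemma nn_integral_markov:
  assumes y: "y \<in> E" and h: "case_prod h \<in> borel_measurable (F n \<Otimes>\<^sub>M S)"
  shows "(\<integral>\<^sup>+\<omega>. h \<omega> (Y (Suc n) \<omega>) \<partial>P y) = (\<integral>\<^sup>+\<omega>. \<integral>\<^sup>+x. h \<omega> x \<partial>K (Y n \<omega>) \<partial>P y)"
proof -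
  define Q where "Q = F n \<Otimes>\<^sub>M S"
  define R where "R = distr (P y) (F n) (\<lambda>\<omega>. \<omega>)"
  define k where "k = (\<lambda>\<omega>. distr (K (Y n \<omega>)) Q (Pair \<omega>))"
  interpret prob_space "P y" by (rule prob_space_P[OF y])
  note [measurable] = measurable_F_P[OF y adapted]
  have id [measurable]: "(\<lambda>\<omega>. \<omega>) \<in> P y \<rightarrow>\<^sub>M F n"
    by (rule measurable_F_P[OF y, of _ n]) simp
  have pr [measurable]: "(\<lambda>\<omega>. (\<omega>, Y (Suc n) \<omega>)) \<in> P y \<rightarrow>\<^sub>M Q"
    unfolding Q_def by measurable
  have Pr: "Pair \<omega> \<in> K x \<rightarrow>\<^sub>M Q" if "\<omega> \<in> space M" for \<omega> x
    using that by (auto simp: Q_def space_F measurable_cong_sets[OF sets_K refl])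
  have k: "k \<in> F n \<rightarrow>\<^sub>M subprob_algebra Q"
    unfolding k_def by (rule measurable_distr2[where M=S]) (auto simp: Q_def)
  have spR: "space R = space M" "sets R = sets (F n)"
    by (auto simp: R_def space_F)
  have kR: "k \<in> R \<rightarrow>\<^sub>M subprob_algebra Q"
    using k by (simp add: R_def)
  have ne: "space M \<noteq> {}"
    using not_empty by (simp add: space_P[OF y])
  have "distr (P y) Q (\<lambda>\<omega>. (\<omega>, Y (Suc n) \<omega>)) = R \<bind> k"
  proof (rule measure_eqI_generator_eq[where E="{A \<times> B | A B. A \<in> sets (F n) \<and> B \<in> sets S}"
        and \<Omega>="space (F n) \<times> space S" and A="\<lambda>_. space (F n) \<times> space S"])
    show "sets (R \<bind> k) = sigma_sets (space (F n) \<times> space S) {A \<times> B | A B. A \<in> sets (F n) \<and> B \<in> sets S}"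
      using sets_bind[of R k Q] kR ne
      by (simp add: spR Q_def sets_pair_measure sets_kernel[OF kR])
    fix X assume "X \<in> {A \<times> B | A B. A \<in> sets (F n) \<and> B \<in> sets S}"
    then obtain A B where X: "X = A \<times> B" and A: "A \<in> sets (F n)" and B: "B \<in> sets S" by auto
    have XQ: "X \<in> sets Q" using A B by (auto simp: X Q_def)
    have Asub: "A \<subseteq> space M" using sets.sets_into_space[OF A] by (simp add: space_F)
    have "emeasure (distr (P y) Q (\<lambda>\<omega>. (\<omega>, Y (Suc n) \<omega>))) X =
        emeasure (P y) (A \<inter> {\<omega> \<in> space M. Y (Suc n) \<omega> \<in> B})"
      by (subst emeasure_distr[OF pr XQ])
         (rule arg_cong[where f="emeasure (P y)"], use Asub in \<open>auto simp: X space_P[OF y]\<close>)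
    also have "\<dots> = (\<integral>\<^sup>+\<omega>. indicator A \<omega> * emeasure (K (Y n \<omega>)) B \<partial>P y)"
      by (rule markov_rectangle[OF y A B])
    also have "\<dots> = (\<integral>\<^sup>+\<omega>. emeasure (k \<omega>) X \<partial>P y)"
    proof (rule nn_integral_cong)
      fix \<omega> assume "\<omega> \<in> space (P y)"
      then have "Pair \<omega> \<in> K (Y n \<omega>) \<rightarrow>\<^sub>M Q" using Pr space_P[OF y] by auto
      then have "emeasure (k \<omega>) X = emeasure (K (Y n \<omega>)) (Pair \<omega> -` X \<inter> E)"
        unfolding k_def by (simp add: emeasure_distr XQ space_K)
      also have "Pair \<omega> -` X \<inter> E = (if \<omega> \<in> A then B else {})"
        using sets.sets_into_space[OF B] by (auto simp: X space_S)
      finally show "indicator A \<omega> * emeasure (K (Y n \<omega>)) B = emeasure (k \<omega>) X"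
        by (simp add: indicator_def)
    qed
    also have "\<dots> = (\<integral>\<^sup>+\<omega>. emeasure (k \<omega>) X \<partial>R)"
      unfolding R_def
      by (subst nn_integral_distr[OF id])
         (use XQ measurable_emeasure_kernel[OF k] in auto)
    also have "\<dots> = emeasure (R \<bind> k) X"
      by (rule emeasure_bind[symmetric, OF _ kR XQ]) (simp add: spR ne)
    finally show "emeasure (distr (P y) Q (\<lambda>\<omega>. (\<omega>, Y (Suc n) \<omega>))) X = emeasure (R \<bind> k) X" .
  next
    show "emeasure (distr (P y) Q (\<lambda>\<omega>. (\<omega>, Y (Suc n) \<omega>))) (space (F n) \<times> space S) \<noteq> \<infinity>" for i :: nat
      by (subst emeasure_distr[OF pr]) (auto simp: Q_def)
  qed (auto simp: Q_def Int_stable_pair_measure_generator sets_pair_measure dest: sets.sets_into_space)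
  then have "(\<integral>\<^sup>+z. case_prod h z \<partial>distr (P y) Q (\<lambda>\<omega>. (\<omega>, Y (Suc n) \<omega>))) = (\<integral>\<^sup>+z. case_prod h z \<partial>(R \<bind> k))"
    by simp
  moreover have "(\<integral>\<^sup>+z. case_prod h z \<partial>(R \<bind> k)) = (\<integral>\<^sup>+\<omega>. \<integral>\<^sup>+z. case_prod h z \<partial>k \<omega> \<partial>R)"
    by (rule nn_integral_bind[OF _ kR]) (use h in \<open>simp add: Q_def\<close>)
  moreover have "\<dots> = (\<integral>\<^sup>+\<omega>. \<integral>\<^sup>+z. case_prod h z \<partial>k \<omega> \<partial>P y)"
    unfolding R_def
    by (subst nn_integral_distr[OF id])
       (auto intro!: measurable_compose[OF k nn_integral_measurable_subprob_algebra] h[folded Q_def])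
  moreover have "\<dots> = (\<integral>\<^sup>+\<omega>. \<integral>\<^sup>+x. h \<omega> x \<partial>K (Y n \<omega>) \<partial>P y)"
  proof (rule nn_integral_cong)
    fix \<omega> assume "\<omega> \<in> space (P y)"
    then have "Pair \<omega> \<in> K (Y n \<omega>) \<rightarrow>\<^sub>M Q" using Pr space_P[OF y] by auto
    then show "(\<integral>\<^sup>+z. case_prod h z \<partial>k \<omega>) = (\<integral>\<^sup>+x. h \<omega> x \<partial>K (Y n \<omega>))"
      unfolding k_def by (subst nn_integral_distr) (auto simp: h[folded Q_def])
  qed
  moreover have "(\<integral>\<^sup>+z. case_prod h z \<partial>distr (P y) Q (\<lambda>\<omega>. (\<omega>, Y (Suc n) \<omega>))) =
      (\<integral>\<^sup>+\<omega>. h \<omega> (Y (Suc n) \<omega>) \<partial>P y)"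
    by (subst nn_integral_distr[OF pr]) (auto simp: h[folded Q_def])
  ultimately show ?thesis
    by simp
qed

end

section \<open>Discounted rewards at first entry times\<close>

lemma suminf_first_hit:
  fixes v :: "nat \<Rightarrow> ennreal"
  shows "(\<Sum>k. if (\<forall>i<k. \<not> Q i) \<and> Q k then v k else 0) = (if \<exists>k. Q k then v (LEAST k. Q k) else 0)"
proof (cases "\<exists>k. Q k")
  case True
  then obtain k where k: "Q k" by blast
  have *: "(\<forall>i<n. \<not> Q i) \<and> Q n \<longleftrightarrow> n = (LEAST k. Q k)" for n
    using LeastI[of Q, OF k] not_less_Least[of _ Q] by (metis linorder_neqE_nat)
  show ?thesis
    unfolding * using True by (simp add: sums_unique[OF sums_single, symmetric])
qed simp

lemma INF_enat_eq: "(INF n\<in>{n. Q n}. enat n) = (if \<exists>n. Q n then enat (LEAST n. Q n) else \<infinity>)"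
proof (cases "\<exists>k. Q k")
  case True
  then have "Q (LEAST n. Q n)" by (rule LeastI_ex)
  then show ?thesis
    using True by (auto intro!: antisym INF_lower INF_greatest Least_le)
qed (simp add: top_enat_def)

lemma stopped_gain_INF:
  assumes \<tau>: "\<tau> \<omega> = (INF n\<in>{n. Q n}. enat n)"
  shows "ennreal (discount \<rho> (\<tau> \<omega>) * stopped_value h Y \<tau> \<omega>) =
    (if \<exists>n. Q n then ennreal (\<rho> ^ (LEAST n. Q n) * h (Y (LEAST n. Q n) \<omega>)) else 0)"
  unfolding discount_def stopped_value_def \<tau> INF_enat_eq by auto

context real_markov_process
begin

text \<open>
  \<open>hit \<rho> B h t x\<close> below is \<open>E\<^sub>x \<rho>\<^sup>\<kappa> h(Y\<^sub>\<kappa>)\<close> for the entry time \<open>\<kappa>\<close> of \<open>B t\<close>, and the \<open>n\<close>-th term is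
  the part on \<open>\<kappa> = n\<close>. It is built from the transition kernel, because the laws \<open>P x\<close> are not assumed
  to depend measurably on \<open>x\<close>, and with a parameter \<open>t\<close>, because \<open>B t\<close> will be the set above the
  running maximum.
\<close>

primrec hit_term :: "real \<Rightarrow> (real \<Rightarrow> real set) \<Rightarrow> (real \<Rightarrow> real) \<Rightarrow> nat \<Rightarrow> real \<Rightarrow> real \<Rightarrow> ennreal"
  where
    "hit_term \<rho> B h 0 = (\<lambda>t x. if x \<in> B t then ennreal (h x) else 0)"
  | "hit_term \<rho> B h (Suc n) = (\<lambda>t x. if x \<in> B t then 0
      else ennreal \<rho> * (\<integral>\<^sup>+x'. hit_term \<rho> B h n t x' \<partial>K x))"

definition hit :: "real \<Rightarrow> (real \<Rightarrow> real set) \<Rightarrow> (real \<Rightarrow> real) \<Rightarrow> real \<Rightarrow> real \<Rightarrow> ennreal"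
  where "hit \<rho> B h t x = (\<Sum>n. hit_term \<rho> B h n t x)"

lemma hit_mem: "x \<in> B t \<Longrightarrow> hit \<rho> B h t x = ennreal (h x)"
proof -
  assume x: "x \<in> B t"
  have "hit_term \<rho> B h n t x = (if n = 0 then ennreal (h x) else 0)" for n
    by (cases n) (simp_all add: x)
  then show ?thesis
    unfolding hit_def by (simp add: sums_unique[OF sums_single, symmetric])
qed

lemma nn_integral_Y0:
  assumes y: "y \<in> E"
  shows "(\<integral>\<^sup>+\<omega>. q (Y 0 \<omega>) \<partial>P y) = q y"
proof -
  interpret prob_space "P y" by (rule prob_space_P[OF y])
  have "(\<integral>\<^sup>+\<omega>. q (Y 0 \<omega>) \<partial>P y) = (\<integral>\<^sup>+\<omega>. q y \<partial>P y)"
    by (rule nn_integral_cong_AE) (use start[OF y] in auto)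
  then show ?thesis by (simp add: emeasure_space_1)
qed

lemma measurable_ident_K: "(\<lambda>x. x) \<in> K x \<rightarrow>\<^sub>M S"
  by (simp add: measurable_cong_sets[OF sets_K refl])

lemma borel_measurable_S_compose:
  "h \<in> borel_measurable borel \<Longrightarrow> X \<in> N \<rightarrow>\<^sub>M S \<Longrightarrow> (\<lambda>\<omega>. h (X \<omega>)) \<in> borel_measurable N"
  using measurable_compose[of X N borel h borel] by (auto simp: measurable_restrict_space2_iff)

context
  fixes B :: "real \<Rightarrow> real set" and h :: "real \<Rightarrow> real"
  assumes B: "Measurable.pred (borel \<Otimes>\<^sub>M borel) (\<lambda>(t, x). x \<in> B t)"
    and h: "h \<in> borel_measurable borel"
begin

lemma pred_B: "\<theta> \<in> borel_measurable N \<Longrightarrow> X \<in> N \<rightarrow>\<^sub>M S \<Longrightarrow> Measurable.pred N (\<lambda>\<omega>. X \<omega> \<in> B (\<theta> \<omega>))"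
  using measurable_compose[OF measurable_Pair B, of \<theta> N X]
  by (auto simp: measurable_restrict_space2_iff)

lemma hit_term_measurable: "case_prod (hit_term \<rho> B h n) \<in> borel_measurable (borel \<Otimes>\<^sub>M S)"
proof (induction n)
  case 0
  have [measurable]: "Measurable.pred (borel \<Otimes>\<^sub>M S) (\<lambda>z. snd z \<in> B (fst z))"
    by (rule pred_B) auto
  have [measurable]: "(\<lambda>z. h (snd z)) \<in> borel_measurable (borel \<Otimes>\<^sub>M S)"
    by (rule borel_measurable_S_compose[OF h]) auto
  show ?case by (simp add: case_prod_beta)
next
  case (Suc n)
  have [measurable]: "Measurable.pred (borel \<Otimes>\<^sub>M S) (\<lambda>z. snd z \<in> B (fst z))"
    by (rule pred_B) auto
  have [measurable]: "(\<lambda>z. \<integral>\<^sup>+x. hit_term \<rho> B h n (fst z) x \<partial>K (snd z)) \<in> borel_measurable (borel \<Otimes>\<^sub>M S)"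
    by (rule borel_measurable_K)
       (use measurable_compose[OF _ Suc.IH, of "\<lambda>z. (fst (fst z), snd z)" "(borel \<Otimes>\<^sub>M S) \<Otimes>\<^sub>M S"]
         in \<open>auto simp: case_prod_beta\<close>)
  show ?case by (simp add: case_prod_beta)
qed

lemma hit_term_measurable':
  "\<theta> \<in> borel_measurable N \<Longrightarrow> X \<in> N \<rightarrow>\<^sub>M S \<Longrightarrow> (\<lambda>\<omega>. hit_term \<rho> B h n (\<theta> \<omega>) (X \<omega>)) \<in> borel_measurable N"
  using measurable_compose[OF measurable_Pair hit_term_measurable, of \<theta> N X] by simp

lemma hit_measurable':
  "\<theta> \<in> borel_measurable N \<Longrightarrow> X \<in> N \<rightarrow>\<^sub>M S \<Longrightarrow> (\<lambda>\<omega>. hit \<rho> B h (\<theta> \<omega>) (X \<omega>)) \<in> borel_measurable N"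
  unfolding hit_def by (intro borel_measurable_suminf_order hit_term_measurable')

lemma hit_not_mem:
  assumes x: "x \<notin> B t"
  shows "hit \<rho> B h t x = ennreal \<rho> * (\<integral>\<^sup>+x'. hit \<rho> B h t x' \<partial>K x)"
proof -
  have "hit \<rho> B h t x = (\<Sum>n. hit_term \<rho> B h (Suc n) t x)"
    unfolding hit_def by (subst suminf_offset[where i=1]) (auto simp: x)
  also have "\<dots> = (\<Sum>n. ennreal \<rho> * (\<integral>\<^sup>+x'. hit_term \<rho> B h n t x' \<partial>K x))"
    by (simp add: x)
  also have "\<dots> = ennreal \<rho> * (\<integral>\<^sup>+x'. hit \<rho> B h t x' \<partial>K x)"
    unfolding hit_def
    by (subst nn_integral_suminf) (auto intro!: hit_term_measurable' measurable_ident_K)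
  finally show ?thesis .
qed

lemma sum_hit_term_Suc:
  assumes x: "x \<notin> B t"
  shows "(\<Sum>n<Suc N. hit_term \<rho> B h n t x) = ennreal \<rho> * (\<integral>\<^sup>+x'. (\<Sum>n<N. hit_term \<rho> B h n t x') \<partial>K x)"
  unfolding sum.lessThan_Suc_shift
  by (subst nn_integral_sum) (auto simp: x sum_distrib_left intro!: hit_term_measurable' measurable_ident_K)

lemma nn_integral_hit_term:
  assumes y: "y \<in> E" and \<rho>: "0 \<le> \<rho>"
    and w: "w \<in> borel_measurable (F j)" and \<theta>: "\<theta> \<in> borel_measurable (F j)"
  shows "(\<integral>\<^sup>+\<omega>. w \<omega> * hit_term \<rho> B h n (\<theta> \<omega>) (Y j \<omega>) \<partial>P y) =
    (\<integral>\<^sup>+\<omega>. w \<omega> * (if (\<forall>i<n. Y (j + i) \<omega> \<notin> B (\<theta> \<omega>)) \<and> Y (j + n) \<omega> \<in> B (\<theta> \<omega>)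
      then ennreal (\<rho> ^ n * h (Y (j + n) \<omega>)) else 0) \<partial>P y)"
  using w \<theta>
proof (induction n arbitrary: j w)
  case 0
  then show ?case by (auto intro!: nn_integral_cong)
next
  case (Suc n)
  note [measurable] = Suc.prems
  define w' where "w' = (\<lambda>\<omega>. w \<omega> * (if Y j \<omega> \<in> B (\<theta> \<omega>) then 0 else ennreal \<rho>))"
  have [measurable]: "Measurable.pred (F j) (\<lambda>\<omega>. Y j \<omega> \<in> B (\<theta> \<omega>))"
    by (rule pred_B) auto
  have w' [measurable]: "w' \<in> borel_measurable (F j)"
    unfolding w'_def by measurable
  have m: "(\<lambda>\<omega>. w' (fst \<omega>) * hit_term \<rho> B h n (\<theta> (fst \<omega>)) (snd \<omega>)) \<in> borel_measurable (F j \<Otimes>\<^sub>M S)"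
    by (intro borel_measurable_times_ennreal hit_term_measurable') auto
  have "(\<integral>\<^sup>+\<omega>. w \<omega> * hit_term \<rho> B h (Suc n) (\<theta> \<omega>) (Y j \<omega>) \<partial>P y) =
      (\<integral>\<^sup>+\<omega>. \<integral>\<^sup>+x. w' \<omega> * hit_term \<rho> B h n (\<theta> \<omega>) x \<partial>K (Y j \<omega>) \<partial>P y)"
    by (subst nn_integral_cmult) (auto simp: w'_def mult.assoc intro!: nn_integral_cong hit_term_measurable' measurable_ident_K)
  also have "\<dots> = (\<integral>\<^sup>+\<omega>. w' \<omega> * hit_term \<rho> B h n (\<theta> \<omega>) (Y (Suc j) \<omega>) \<partial>P y)"
    by (rule nn_integral_markov[symmetric, OF y]) (use m in \<open>simp add: case_prod_beta\<close>)
  also have "\<dots> = (\<integral>\<^sup>+\<omega>. w' \<omega> * (if (\<forall>i<n. Y (Suc j + i) \<omega> \<notin> B (\<theta> \<omega>)) \<and> Y (Suc j + n) \<omega> \<in> B (\<theta> \<omega>)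
      then ennreal (\<rho> ^ n * h (Y (Suc j + n) \<omega>)) else 0) \<partial>P y)"
    by (rule Suc.IH) (auto intro: measurable_F_mono[of j "Suc j"])
  also have "\<dots> = (\<integral>\<^sup>+\<omega>. w \<omega> * (if (\<forall>i<Suc n. Y (j + i) \<omega> \<notin> B (\<theta> \<omega>)) \<and> Y (j + Suc n) \<omega> \<in> B (\<theta> \<omega>)
      then ennreal (\<rho> ^ Suc n * h (Y (j + Suc n) \<omega>)) else 0) \<partial>P y)"
    using \<rho> by (intro nn_integral_cong)
      (auto simp: w'_def All_less_Suc2 mult.assoc ennreal_mult' simp flip: ennreal_mult')
  finally show ?case .
qed

lemma nn_integral_hit:
  assumes y: "y \<in> E" and \<rho>: "0 \<le> \<rho>"
    and w: "w \<in> borel_measurable (F j)" and \<theta>: "\<theta> \<in> borel_measurable (F j)"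
  shows "(\<integral>\<^sup>+\<omega>. w \<omega> * hit \<rho> B h (\<theta> \<omega>) (Y j \<omega>) \<partial>P y) =
    (\<integral>\<^sup>+\<omega>. w \<omega> * (if \<exists>n. Y (j + n) \<omega> \<in> B (\<theta> \<omega>)
      then ennreal (\<rho> ^ (LEAST n. Y (j + n) \<omega> \<in> B (\<theta> \<omega>)) * h (Y (j + (LEAST n. Y (j + n) \<omega> \<in> B (\<theta> \<omega>))) \<omega>))
      else 0) \<partial>P y)"
proof -
  have mP: "X \<in> P y \<rightarrow>\<^sub>M N" if "X \<in> F k \<rightarrow>\<^sub>M N" for X N k
    using measurable_F_P[OF y that] .
  note [measurable] = mP[OF w] mP[OF \<theta>] mP[OF adapted]
  have [measurable]: "Measurable.pred (P y) (\<lambda>\<omega>. Y i \<omega> \<in> B (\<theta> \<omega>))" for i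
    by (rule pred_B) auto
  have [measurable]: "(\<lambda>\<omega>. h (Y i \<omega>)) \<in> borel_measurable (P y)" for i
    by (rule borel_measurable_S_compose[OF h]) auto
  have "(\<integral>\<^sup>+\<omega>. w \<omega> * hit \<rho> B h (\<theta> \<omega>) (Y j \<omega>) \<partial>P y) =
      (\<Sum>n. \<integral>\<^sup>+\<omega>. w \<omega> * hit_term \<rho> B h n (\<theta> \<omega>) (Y j \<omega>) \<partial>P y)"
    unfolding hit_def
    by (subst nn_integral_suminf[symmetric])
       (auto intro!: borel_measurable_times_ennreal hit_term_measurable')
  also have "\<dots> = (\<Sum>n. \<integral>\<^sup>+\<omega>. w \<omega> * (if (\<forall>i<n. Y (j + i) \<omega> \<notin> B (\<theta> \<omega>)) \<and> Y (j + n) \<omega> \<in> B (\<theta> \<omega>)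
      then ennreal (\<rho> ^ n * h (Y (j + n) \<omega>)) else 0) \<partial>P y)"
    by (simp add: nn_integral_hit_term[OF y \<rho> w \<theta>])
  also have "\<dots> = (\<integral>\<^sup>+\<omega>. w \<omega> * (\<Sum>n. if (\<forall>i<n. Y (j + i) \<omega> \<notin> B (\<theta> \<omega>)) \<and> Y (j + n) \<omega> \<in> B (\<theta> \<omega>)
      then ennreal (\<rho> ^ n * h (Y (j + n) \<omega>)) else 0) \<partial>P y)"
    by (subst nn_integral_suminf[symmetric]) auto
  finally show ?thesis
    by (simp only: suminf_first_hit[where v="\<lambda>n. ennreal (\<rho> ^ n * h (Y (j + n) _))"])
qed

end

lemma gain_entry_time:
  assumes y: "y \<in> E" and \<rho>: "0 \<le> \<rho>" and U: "U \<in> sets borel" and h: "h \<in> borel_measurable borel"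
  shows "gain P Y \<rho> h (entry_time Y U) y = hit \<rho> (\<lambda>_. U) h t y"
proof -
  have "Measurable.pred (borel \<Otimes>\<^sub>M borel) (\<lambda>(t::real, x). x \<in> U)"
    using U by measurable
  from nn_integral_hit[OF this h y \<rho>, of "\<lambda>_. 1" 0 "\<lambda>_. t"] nn_integral_Y0[OF y]
  show ?thesis
    by (simp cong: if_cong add: gain_def stopped_gain_INF[of "entry_time Y U" _ "\<lambda>n. Y n _ \<in> U", OF entry_time_def])
qed

lemma pred_greaterThan: "Measurable.pred (borel \<Otimes>\<^sub>M borel) (\<lambda>(t::real, x). x \<in> {t<..})"
  by simp

lemma gain_ladder_time:
  assumes y: "y \<in> E" and \<rho>: "0 \<le> \<rho>" and h: "h \<in> borel_measurable borel"
  shows "gain P Y \<rho> h (ladder_time Y y) y = ennreal \<rho> * (\<integral>\<^sup>+x. hit \<rho> greaterThan h y x \<partial>K y)"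
proof -
  have *: "ennreal (discount \<rho> (ladder_time Y y \<omega>) * stopped_value h Y (ladder_time Y y) \<omega>) =
     ennreal \<rho> * (if \<exists>n. Y (1 + n) \<omega> \<in> {y<..}
      then ennreal (\<rho> ^ (LEAST n. Y (1 + n) \<omega> \<in> {y<..}) * h (Y (1 + (LEAST n. Y (1 + n) \<omega> \<in> {y<..})) \<omega>))
      else 0)" for \<omega>
  proof -
    have ex: "(\<exists>n. 0 < n \<and> y < Y n \<omega>) \<longleftrightarrow> (\<exists>n. y < Y (Suc n) \<omega>)"
      by (metis gr0_implies_Suc zero_less_Suc)
    have "(LEAST n. 0 < n \<and> y < Y n \<omega>) = Suc (LEAST n. y < Y (Suc n) \<omega>)" if "y < Y (Suc n) \<omega>" for n
      by (subst Least_Suc[where n="Suc n"]) (use that in auto)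
    then show ?thesis
      unfolding stopped_gain_INF[of "ladder_time Y y" \<omega> "\<lambda>n. 0 < n \<and> y < Y n \<omega>", OF ladder_time_def] ex using \<rho>
      by (auto simp: mult.assoc ennreal_mult' simp flip: ennreal_mult')
  qed
  have "gain P Y \<rho> h (ladder_time Y y) y = (\<integral>\<^sup>+\<omega>. ennreal \<rho> * hit \<rho> greaterThan h y (Y 1 \<omega>) \<partial>P y)"
    unfolding gain_def *
    by (rule nn_integral_hit[symmetric, OF pred_greaterThan h y \<rho>, of "\<lambda>_. ennreal \<rho>" 1 "\<lambda>_. y"]) auto
  also have "\<dots> = ennreal \<rho> * (\<integral>\<^sup>+\<omega>. hit \<rho> greaterThan h y (Y 1 \<omega>) \<partial>P y)"
    by (rule nn_integral_cmult, rule hit_measurable'[OF pred_greaterThan h])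
       (auto intro: measurable_F_P[OF y adapted])
  also have "(\<integral>\<^sup>+\<omega>. hit \<rho> greaterThan h y (Y 1 \<omega>) \<partial>P y) = (\<integral>\<^sup>+x. hit \<rho> greaterThan h y x \<partial>K y)"
    unfolding transition_def
    by (rule nn_integral_distr[symmetric])
       (auto intro!: hit_measurable'[OF pred_greaterThan h] measurable_F_P[OF y adapted])
  finally show ?thesis .
qed

end

section \<open>Comparison along the records\<close>

text \<open>
  The maximum of \<open>b\<close> and the states strictly before time \<open>n\<close>, so that \<open>n\<close> is a record time if
  \<open>running_max b Y n \<omega> < Y n \<omega>\<close>.
\<close>

primrec running_max :: "real \<Rightarrow> (nat \<Rightarrow> 'a \<Rightarrow> real) \<Rightarrow> nat \<Rightarrow> 'a \<Rightarrow> real"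
  where
    "running_max b Y 0 = (\<lambda>\<omega>. b)"
  | "running_max b Y (Suc n) = (\<lambda>\<omega>. max (running_max b Y n \<omega>) (Y n \<omega>))"

lemma running_max_not_mem:
  assumes up: "\<And>x x'. x \<in> U \<Longrightarrow> x \<le> x' \<Longrightarrow> x' \<in> U" and b: "b \<notin> U" and "\<forall>i<n. Y i \<omega> \<notin> U"
  shows "running_max b Y n \<omega> \<notin> U"
  using assms(3) by (induction n) (auto simp: b max_def)

lemma running_max_Suc_ge: "Y 0 \<omega> \<le> running_max b Y (Suc n) \<omega>"
  by (induction n) auto

lemma tendsto_SUP_tail_zero:
  fixes X :: "nat \<Rightarrow> ennreal"
  assumes "X \<longlonglongrightarrow> 0"
  shows "(\<lambda>n. SUP k. X (n + k)) \<longlonglongrightarrow> 0"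
proof -
  have *: "(SUP k. X (n + k)) = (SUP k\<in>{n..}. X k)" for n
    by (rule SUP_eq) (auto, metis le_add_diff_inverse order_refl)
  have "(\<lambda>n. SUP k\<in>{n..}. X k) \<longlonglongrightarrow> (INF n. SUP k\<in>{n..}. X k)"
    by (rule LIMSEQ_INF) (auto simp: decseq_def intro!: SUP_subset_mono)
  also have "(INF n. SUP k\<in>{n..}. X k) = 0"
    using lim_imp_Limsup[OF _ assms] by (simp add: limsup_INF_SUP)
  finally show ?thesis by (simp add: *)
qed

context real_markov_process
begin

lemma hit_one_le:
  assumes B: "Measurable.pred (borel \<Otimes>\<^sub>M borel) (\<lambda>(t, x). x \<in> B t)"
    and \<rho>: "0 \<le> \<rho>" "\<rho> \<le> 1" and x: "x \<in> E"
  shows "hit \<rho> B (\<lambda>_. 1) t x \<le> 1"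
proof -
  have "(\<Sum>n<N. hit_term \<rho> B (\<lambda>_. 1) n t x) \<le> 1" for N
    using x
  proof (induction N arbitrary: x)
    case (Suc N)
    show ?case
    proof (cases "x \<in> B t")
      case True
      have "hit_term \<rho> B (\<lambda>_. 1) n t x = (if n = 0 then 1 else 0)" for n
        by (cases n) (simp_all add: True)
      then show ?thesis by simp
    next
      case False
      interpret prob_space "K x" by (rule prob_space_K[OF Suc.prems])
      have "(\<integral>\<^sup>+x'. (\<Sum>n<N. hit_term \<rho> B (\<lambda>_. 1) n t x') \<partial>K x) \<le> (\<integral>\<^sup>+x'. 1 \<partial>K x)"
        by (rule nn_integral_mono) (simp add: Suc.IH space_K)
      then show ?thesis
        unfolding sum_hit_term_Suc[OF B borel_measurable_const False]
        using \<rho> mult_mono[of "ennreal \<rho>" 1 _ 1] by (simp add: emeasure_space_1 ennreal_le_1)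
    qed
  qed simp
  then show ?thesis
    unfolding hit_def suminf_eq_SUP by (rule SUP_least)
qed

lemma running_max_measurable: "running_max b Y n \<in> borel_measurable (F n)"
proof (induction n)
  case (Suc n)
  have "Y n \<in> borel_measurable (F n)"
    using adapted[of n] by (simp add: measurable_restrict_space2_iff)
  with Suc have "running_max b Y (Suc n) \<in> borel_measurable (F n)" by simp
  then show ?case by (rule measurable_F_mono[rotated]) simp
qed simp

lemma tendsto_nn_integral_tail:
  assumes y: "y \<in> E" and g: "g \<in> borel_measurable borel"
    and fin: "(\<integral>\<^sup>+\<omega>. (SUP n. ennreal (\<rho> ^ n * g (Y n \<omega>))) \<partial>P y) < \<infinity>"
    and lim: "AE \<omega> in P y. (\<lambda>n. \<rho> ^ n * g (Y n \<omega>)) \<longlonglongrightarrow> 0"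
  shows "(\<lambda>n. \<integral>\<^sup>+\<omega>. (SUP k. ennreal (\<rho> ^ (n + k) * g (Y (n + k) \<omega>))) \<partial>P y) \<longlonglongrightarrow> 0"
proof -
  have [measurable]: "(\<lambda>\<omega>. g (Y n \<omega>)) \<in> borel_measurable (P y)" for n
    by (rule measurable_F_P[OF y, of _ n], rule borel_measurable_S_compose[OF g adapted])
  have "(\<lambda>n. \<integral>\<^sup>+\<omega>. (SUP k. ennreal (\<rho> ^ (n + k) * g (Y (n + k) \<omega>))) \<partial>P y) \<longlonglongrightarrow> (\<integral>\<^sup>+\<omega>. 0 \<partial>P y)"
  proof (rule nn_integral_dominated_convergence[where w="\<lambda>\<omega>. SUP n. ennreal (\<rho> ^ n * g (Y n \<omega>))"])
    show "AE \<omega> in P y. (SUP k. ennreal (\<rho> ^ (n + k) * g (Y (n + k) \<omega>))) \<le> (SUP n. ennreal (\<rho> ^ n * g (Y n \<omega>)))" for n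
      by (intro AE_I2 SUP_mono) auto
    show "AE \<omega> in P y. (\<lambda>n. SUP k. ennreal (\<rho> ^ (n + k) * g (Y (n + k) \<omega>))) \<longlonglongrightarrow> 0"
      using lim
    proof eventually_elim
      case (elim \<omega>)
      have "(\<lambda>n. ennreal (\<rho> ^ n * g (Y n \<omega>))) \<longlonglongrightarrow> 0"
        using tendsto_ennrealI[OF elim] by simp
      then show ?case by (rule tendsto_SUP_tail_zero)
    qed
  qed (use fin in auto)
  then show ?thesis by simp
qed

text \<open>
  Instead of stopping at the random record times, the proof follows for every \<open>n\<close> the expected reward
  at the first record from \<open>n\<close> on: it moves by one time step at a time and changes only at records,
  where \<open>step\<close> applies. The terms with \<open>c\<close> are moved so that no subtraction in \<^typ>\<open>ennreal\<close> occurs.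
\<close>

lemma hit_dominates:
  assumes \<rho>: "0 \<le> \<rho>" "\<rho> \<le> 1" and g: "g \<in> borel_measurable borel"
    and z: "z \<in> E"
    and fin: "(\<integral>\<^sup>+\<omega>. (SUP n. ennreal (\<rho> ^ n * g (Y n \<omega>))) \<partial>P z) < \<infinity>"
    and lim: "AE \<omega> in P z. (\<lambda>n. \<rho> ^ n * g (Y n \<omega>)) \<longlonglongrightarrow> 0"
    and U: "U \<in> sets borel" and up: "\<And>x x'. x \<in> U \<Longrightarrow> x \<le> x' \<Longrightarrow> x' \<in> U"
    and c: "c < \<infinity>"
    and step: "\<And>x. x \<in> E \<Longrightarrow> z \<le> x \<Longrightarrow> x \<notin> U \<Longrightarrow>
      ennreal (g x) + c * (ennreal \<rho> * (\<integral>\<^sup>+x'. hit \<rho> greaterThan (\<lambda>_. 1) x x' \<partial>K x))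
      \<le> c + ennreal \<rho> * (\<integral>\<^sup>+x'. hit \<rho> greaterThan g x x' \<partial>K x)"
  shows "ennreal (g z) + c * hit \<rho> (\<lambda>_. U) (\<lambda>_. 1) t z \<le> c + hit \<rho> (\<lambda>_. U) g t z"
proof (cases "z \<in> U")
  case True
  then show ?thesis by (simp add: hit_mem add.commute)
next
  case zU: False
  interpret prob_space "P z" by (rule prob_space_P[OF z])
  define m where "m = running_max (z - 1) Y"
  define A where "A = (\<lambda>n \<omega>. \<forall>i<n. Y i \<omega> \<notin> U)"
  define w where "w = (\<lambda>n \<omega>. if A n \<omega> then ennreal (\<rho> ^ n) else 0)"
  define w' where "w' = (\<lambda>n \<omega>. if A n \<omega> \<and> Y n \<omega> \<notin> U then ennreal (\<rho> ^ n) else 0)"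
  define \<alpha> where "\<alpha> = (\<lambda>q n. \<integral>\<^sup>+\<omega>. w n \<omega> * hit \<rho> greaterThan q (m n \<omega>) (Y n \<omega>) \<partial>P z)"
  define \<beta> where "\<beta> = (\<lambda>q n. \<integral>\<^sup>+\<omega>. w' n \<omega> * hit \<rho> greaterThan q (m n \<omega>) (Y n \<omega>) \<partial>P z)"
  define \<gamma> where "\<gamma> = (\<lambda>q n \<omega>. ennreal \<rho> * (\<integral>\<^sup>+x. hit \<rho> greaterThan q (m (Suc n) \<omega>) x \<partial>K (Y n \<omega>)))"
  define G where "G = (\<lambda>q n. \<Sum>k<n. hit_term \<rho> (\<lambda>_. U) q k t z)"
  have one: "(\<lambda>_. 1 :: real) \<in> borel_measurable borel" by simp
  note gt = pred_greaterThan
  have mP: "X \<in> P z \<rightarrow>\<^sub>M N" if "X \<in> F k \<rightarrow>\<^sub>M N" for X k and N :: "'c measure"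
    using measurable_F_P[OF z that] .
  have Yb: "Y k \<in> borel_measurable (F k)" for k
    using adapted[of k] by (simp add: measurable_restrict_space2_iff)
  have m [measurable]: "m n \<in> borel_measurable (F n)" for n
    unfolding m_def by (rule running_max_measurable)
  have m' [measurable]: "m (Suc n) \<in> borel_measurable (F n)" for n
    using m[of n] Yb[of n] by (simp add: m_def)
  have YU [measurable]: "Measurable.pred (F n) (\<lambda>\<omega>. Y i \<omega> \<in> U)" if "i \<le> n" for i n
    using measurable_F_mono[OF that Yb] U by measurable
  have A [measurable]: "Measurable.pred (F n) (A n)" for n
    unfolding A_def by measurable
  have [measurable]: "Measurable.pred (F n) (\<lambda>\<omega>. Y n \<omega> \<in> U)" for n
    by (rule YU) simp
  have w [measurable]: "w n \<in> borel_measurable (F n)" and w' [measurable]: "w' n \<in> borel_measurable (F n)" for n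
    unfolding w_def w'_def by measurable
  have hm: "(\<lambda>\<omega>. hit \<rho> greaterThan q (m n \<omega>) (Y n \<omega>)) \<in> borel_measurable (F n)"
    if "q \<in> borel_measurable borel" for q n
    by (rule hit_measurable'[OF gt that]) auto
  have \<gamma>m: "\<gamma> q n \<in> borel_measurable (F n)" if "q \<in> borel_measurable borel" for q n
    unfolding \<gamma>_def
    by (intro borel_measurable_times_ennreal borel_measurable_const borel_measurable_K)
       (auto simp: split_beta' intro!: hit_measurable'[OF gt that])
  have wS: "w (Suc n) \<omega> = w' n \<omega> * ennreal \<rho>" for n \<omega>
    using \<rho> by (auto simp: w_def w'_def A_def less_Suc_eq ennreal_mult mult.commute)
  have next_\<alpha>: "\<alpha> q (Suc n) = (\<integral>\<^sup>+\<omega>. w' n \<omega> * \<gamma> q n \<omega> \<partial>P z)"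
    if q: "q \<in> borel_measurable borel" for q n
  proof -
    have "\<alpha> q (Suc n) = (\<integral>\<^sup>+\<omega>. \<integral>\<^sup>+x. w' n \<omega> * ennreal \<rho> * hit \<rho> greaterThan q (m (Suc n) \<omega>) x \<partial>K (Y n \<omega>) \<partial>P z)"
      unfolding \<alpha>_def wS
      by (rule nn_integral_markov[OF z])
         (auto simp: split_beta' intro!: borel_measurable_times_ennreal hit_measurable'[OF gt q])
    also have "\<dots> = (\<integral>\<^sup>+\<omega>. w' n \<omega> * \<gamma> q n \<omega> \<partial>P z)"
      unfolding \<gamma>_def
      by (subst nn_integral_cmult) (auto simp: mult.assoc intro!: hit_measurable'[OF gt q] measurable_ident_K)
    finally show ?thesis .
  qed
  have split: "G q n + \<alpha> q n = G q (Suc n) + \<beta> q n" if q: "q \<in> borel_measurable borel" for q n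
  proof -
    have Um: "Measurable.pred (borel \<Otimes>\<^sub>M borel) (\<lambda>(t::real, x). x \<in> U)"
      using U by measurable
    have "hit_term \<rho> (\<lambda>_. U) q n t z =
        (\<integral>\<^sup>+\<omega>. (if A n \<omega> \<and> Y n \<omega> \<in> U then ennreal (\<rho> ^ n * q (Y n \<omega>)) else 0) \<partial>P z)"
      using nn_integral_hit_term[OF Um q z \<rho>(1), of "\<lambda>_. 1" 0 "\<lambda>_. t" n]
        nn_integral_Y0[OF z, of "hit_term \<rho> (\<lambda>_. U) q n t"]
      by (simp add: A_def cong: if_cong)
    moreover have "\<alpha> q n = (\<integral>\<^sup>+\<omega>. (if A n \<omega> \<and> Y n \<omega> \<in> U then ennreal (\<rho> ^ n * q (Y n \<omega>)) else 0)
        + w' n \<omega> * hit \<rho> greaterThan q (m n \<omega>) (Y n \<omega>) \<partial>P z)"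
      unfolding \<alpha>_def
    proof (rule nn_integral_cong)
      fix \<omega>
      have "z - 1 \<notin> U" using up[of "z - 1" z] zU by auto
      then have "m n \<omega> \<notin> U" if "A n \<omega>"
        unfolding m_def using that by (intro running_max_not_mem[OF up]) (auto simp: A_def)
      then have "m n \<omega> < Y n \<omega>" if "A n \<omega>" "Y n \<omega> \<in> U"
        using that up[of "Y n \<omega>" "m n \<omega>"] by (meson not_le)
      then have "hit \<rho> greaterThan q (m n \<omega>) (Y n \<omega>) = ennreal (q (Y n \<omega>))" if "A n \<omega>" "Y n \<omega> \<in> U"
        using that by (intro hit_mem) auto
      then show "w n \<omega> * hit \<rho> greaterThan q (m n \<omega>) (Y n \<omega>) =
          (if A n \<omega> \<and> Y n \<omega> \<in> U then ennreal (\<rho> ^ n * q (Y n \<omega>)) else 0)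
          + w' n \<omega> * hit \<rho> greaterThan q (m n \<omega>) (Y n \<omega>)"
        using \<rho> by (auto simp: w_def w'_def ennreal_mult')
    qed
    moreover have "\<dots> = (\<integral>\<^sup>+\<omega>. (if A n \<omega> \<and> Y n \<omega> \<in> U then ennreal (\<rho> ^ n * q (Y n \<omega>)) else 0) \<partial>P z) + \<beta> q n"
      unfolding \<beta>_def
    proof (rule nn_integral_add)
      have [measurable]: "(\<lambda>\<omega>. q (Y n \<omega>)) \<in> borel_measurable (F n)"
        by (rule borel_measurable_S_compose[OF q adapted])
      show "(\<lambda>\<omega>. if A n \<omega> \<and> Y n \<omega> \<in> U then ennreal (\<rho> ^ n * q (Y n \<omega>)) else 0) \<in> borel_measurable (P z)"
        by (rule mP[of _ n]) measurable
      show "(\<lambda>\<omega>. w' n \<omega> * hit \<rho> greaterThan q (m n \<omega>) (Y n \<omega>)) \<in> borel_measurable (P z)"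
        by (rule mP[of _ n], intro borel_measurable_times_ennreal w' hm[OF q])
    qed
    ultimately show ?thesis by (simp add: G_def add.assoc)
  qed
  have pointwise: "hit \<rho> greaterThan g (m n \<omega>) (Y n \<omega>) + c * \<gamma> (\<lambda>_. 1) n \<omega>
      \<le> c * hit \<rho> greaterThan (\<lambda>_. 1) (m n \<omega>) (Y n \<omega>) + \<gamma> g n \<omega>"
    if \<omega>: "\<omega> \<in> space M" "Y 0 \<omega> = z" "Y n \<omega> \<notin> U" for n \<omega>
  proof (cases "m n \<omega> < Y n \<omega>")
    case True
    then have ms: "m (Suc n) \<omega> = Y n \<omega>" by (simp add: m_def)
    have "z \<le> Y n \<omega>"
      using running_max_Suc_ge[of Y \<omega> "z - 1" n] \<omega>(2) ms by (simp add: m_def)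
    then show ?thesis
      using True step[OF Y_in_E[OF \<omega>(1)] _ \<omega>(3)] by (simp add: \<gamma>_def hit_mem ms)
  next
    case False
    then have ms: "m (Suc n) \<omega> = m n \<omega>" by (simp add: m_def)
    have "hit \<rho> greaterThan q (m n \<omega>) (Y n \<omega>) = \<gamma> q n \<omega>" if "q \<in> borel_measurable borel" for q
      using False hit_not_mem[OF gt that, of "Y n \<omega>" "m n \<omega>"] by (simp add: \<gamma>_def ms)
    then show ?thesis using g by (simp add: add.commute)
  qed
  have integrated: "\<beta> g n + c * \<alpha> (\<lambda>_. 1) (Suc n) \<le> c * \<beta> (\<lambda>_. 1) n + \<alpha> g (Suc n)" for n
  proof -
    note [measurable] = mP[OF w'] mP[OF hm[OF g]] mP[OF hm[OF one]] mP[OF \<gamma>m[OF g]] mP[OF \<gamma>m[OF one]]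
    have "\<beta> g n + c * \<alpha> (\<lambda>_. 1) (Suc n) =
        (\<integral>\<^sup>+\<omega>. w' n \<omega> * hit \<rho> greaterThan g (m n \<omega>) (Y n \<omega>) + c * (w' n \<omega> * \<gamma> (\<lambda>_. 1) n \<omega>) \<partial>P z)"
      unfolding next_\<alpha>[OF one] \<beta>_def by (subst nn_integral_add) (auto simp: nn_integral_cmult)
    also have "\<dots> \<le> (\<integral>\<^sup>+\<omega>. c * (w' n \<omega> * hit \<rho> greaterThan (\<lambda>_. 1) (m n \<omega>) (Y n \<omega>)) + w' n \<omega> * \<gamma> g n \<omega> \<partial>P z)"
    proof (rule nn_integral_mono_AE)
      show "AE \<omega> in P z. w' n \<omega> * hit \<rho> greaterThan g (m n \<omega>) (Y n \<omega>) + c * (w' n \<omega> * \<gamma> (\<lambda>_. 1) n \<omega>)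
        \<le> c * (w' n \<omega> * hit \<rho> greaterThan (\<lambda>_. 1) (m n \<omega>) (Y n \<omega>)) + w' n \<omega> * \<gamma> g n \<omega>"
        using start[OF z] AE_space
      proof eventually_elim
        case (elim \<omega>)
        show ?case
        proof (cases "Y n \<omega> \<in> U")
          case False
          have "\<omega> \<in> space M" using elim space_P[OF z] by simp
          from mult_left_mono[OF pointwise[OF this elim(1) False], of "w' n \<omega>"]
          show ?thesis by (simp add: distrib_left mult.left_commute)
        qed (simp add: w'_def)
      qed
    qed
    also have "\<dots> = c * \<beta> (\<lambda>_. 1) n + \<alpha> g (Suc n)"
      unfolding next_\<alpha>[OF g] \<beta>_def by (subst nn_integral_add) (auto simp: nn_integral_cmult)
    finally show ?thesis .
  qed
  have \<beta>_fin: "\<beta> (\<lambda>_. 1) n \<le> 1" for n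
  proof -
    have "\<beta> (\<lambda>_. 1) n \<le> (\<integral>\<^sup>+\<omega>. 1 \<partial>P z)"
      unfolding \<beta>_def
    proof (rule nn_integral_mono)
      fix \<omega> assume "\<omega> \<in> space (P z)"
      then have "hit \<rho> greaterThan (\<lambda>_. 1) (m n \<omega>) (Y n \<omega>) \<le> 1"
        using hit_one_le[OF gt \<rho>] Y_in_E space_P[OF z] by simp
      moreover have "w' n \<omega> \<le> 1"
        using \<rho> by (auto simp: w'_def power_le_one ennreal_le_1)
      ultimately show "w' n \<omega> * hit \<rho> greaterThan (\<lambda>_. 1) (m n \<omega>) (Y n \<omega>) \<le> 1"
        using mult_mono[of "w' n \<omega>" 1 _ 1] by simp
    qed
    then show ?thesis by (simp add: emeasure_space_1)
  qed
  have main: "ennreal (g z) + c * G (\<lambda>_. 1) n + c * \<alpha> (\<lambda>_. 1) n \<le> c + G g n + \<alpha> g n" for n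
  proof (induction n)
    case 0
    have "\<alpha> q 0 = ennreal (q z)" for q
      using nn_integral_Y0[OF z, of "hit \<rho> greaterThan q (z - 1)"]
      by (simp add: \<alpha>_def w_def A_def m_def hit_mem)
    then show ?case by (simp add: G_def add.commute)
  next
    case (Suc n)
    let ?b = "c * \<beta> (\<lambda>_. 1) n"
    have "ennreal (g z) + c * G (\<lambda>_. 1) (Suc n) + ?b = ennreal (g z) + c * (G (\<lambda>_. 1) n + \<alpha> (\<lambda>_. 1) n)"
      by (simp add: split[OF one] distrib_left add.assoc)
    also have "\<dots> \<le> c + (G g n + \<alpha> g n)"
      using Suc.IH by (simp add: distrib_left add.assoc)
    also have "\<dots> = c + G g (Suc n) + \<beta> g n"
      by (simp add: split[OF g] add.assoc)
    finally have "ennreal (g z) + c * G (\<lambda>_. 1) (Suc n) + ?b + c * \<alpha> (\<lambda>_. 1) (Suc n)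
        \<le> c + G g (Suc n) + \<beta> g n + c * \<alpha> (\<lambda>_. 1) (Suc n)"
      by (rule add_right_mono)
    also have "\<dots> \<le> c + G g (Suc n) + (?b + \<alpha> g (Suc n))"
      using add_left_mono[OF integrated[of n], of "c + G g (Suc n)"] by (simp add: add.assoc)
    finally have "?b + (ennreal (g z) + c * G (\<lambda>_. 1) (Suc n) + c * \<alpha> (\<lambda>_. 1) (Suc n))
        \<le> ?b + (c + G g (Suc n) + \<alpha> g (Suc n))"
      by (simp add: ac_simps)
    moreover have "?b \<noteq> \<infinity>"
      using c \<beta>_fin[of n] by (auto simp: ennreal_mult_eq_top_iff top_unique)
    ultimately show ?case by (simp add: ennreal_add_left_cancel_le)
  qed
  have \<alpha>0: "\<alpha> g \<longlonglongrightarrow> 0"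
  proof (rule tendsto_sandwich[OF _ _ tendsto_const tendsto_nn_integral_tail[OF z g fin lim]])
    show "\<forall>\<^sub>F n in sequentially. \<alpha> g n \<le> (\<integral>\<^sup>+\<omega>. (SUP k. ennreal (\<rho> ^ (n + k) * g (Y (n + k) \<omega>))) \<partial>P z)"
    proof (rule eventuallyI)
      fix n
      show "\<alpha> g n \<le> (\<integral>\<^sup>+\<omega>. (SUP k. ennreal (\<rho> ^ (n + k) * g (Y (n + k) \<omega>))) \<partial>P z)"
        unfolding \<alpha>_def nn_integral_hit[OF gt g z \<rho>(1) w m]
      proof (rule nn_integral_mono)
        fix \<omega>
        let ?L = "LEAST k. Y (n + k) \<omega> \<in> {m n \<omega><..}"
        have "ennreal (\<rho> ^ n) * ennreal (\<rho> ^ ?L * g (Y (n + ?L) \<omega>)) = ennreal (\<rho> ^ (n + ?L) * g (Y (n + ?L) \<omega>))"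
          using \<rho> by (simp add: power_add mult.assoc flip: ennreal_mult')
        also have "\<dots> \<le> (SUP k. ennreal (\<rho> ^ (n + k) * g (Y (n + k) \<omega>)))"
          by (rule SUP_upper) simp
        finally show "w n \<omega> * (if \<exists>k. Y (n + k) \<omega> \<in> {m n \<omega><..}
            then ennreal (\<rho> ^ ?L * g (Y (n + ?L) \<omega>)) else 0)
          \<le> (SUP k. ennreal (\<rho> ^ (n + k) * g (Y (n + k) \<omega>)))"
          by (simp add: w_def)
      qed
    qed
  qed simp
  have Glim: "G q \<longlonglongrightarrow> hit \<rho> (\<lambda>_. U) q t z" for q
    unfolding G_def hit_def by (rule summable_LIMSEQ) simp
  have "(\<lambda>n. ennreal (g z) + c * G (\<lambda>_. 1) n) \<longlonglongrightarrow> ennreal (g z) + c * hit \<rho> (\<lambda>_. U) (\<lambda>_. 1) t z"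
    using c by (intro tendsto_intros Glim ennreal_tendsto_cmult) simp
  moreover have "(\<lambda>n. c + G g n + \<alpha> g n) \<longlonglongrightarrow> c + hit \<rho> (\<lambda>_. U) g t z + 0"
    by (intro tendsto_intros Glim \<alpha>0)
  moreover have "ennreal (g z) + c * G (\<lambda>_. 1) n \<le> c + G g n + \<alpha> g n" for n
    using order_trans[OF add_increasing2[OF zero_le order_refl] main] .
  ultimately show ?thesis
    using LIMSEQ_le[of _ _ "\<lambda>n. c + G g n + \<alpha> g n"] by auto
qed

section \<open>Stopping times and excessive functions\<close>

lemma stopping_times_INF:
  assumes "\<And>\<omega>. \<tau> \<omega> = (INF n\<in>{n. Q n \<omega>}. enat n)" and Q: "\<And>n. Measurable.pred (F n) (Q n)"
  shows "\<tau> \<in> stopping_times M F"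
  unfolding stopping_times_def mem_Collect_eq stopping_time_def
proof
  fix t :: enat
  show "Measurable.pred (case_enat F M t) (\<lambda>\<omega>. \<tau> \<omega> \<le> t)"
  proof (cases t)
    case (enat n)
    have Qn [measurable]: "Measurable.pred (F n) (Q k)" if "k \<le> n" for k
      by (rule measurable_F_mono[OF that Q])
    have "\<tau> \<omega> \<le> enat n \<longleftrightarrow> (\<exists>k\<in>{..n}. Q k \<omega>)" for \<omega>
      unfolding assms(1) INF_enat_eq by (auto intro: LeastI Least_le order_trans)
    moreover have "Measurable.pred (F n) (\<lambda>\<omega>. \<exists>k\<in>{..n}. Q k \<omega>)"
      by (rule pred_intros_finite(4)) (auto intro: Qn)
    ultimately show ?thesis by (simp add: enat)
  qed simp
qed

lemma stopping_times_entry_time: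
  assumes "U \<in> sets borel"
  shows "entry_time Y U \<in> stopping_times M F"
proof (rule stopping_times_INF[OF entry_time_def])
  have "Y n \<in> borel_measurable (F n)" for n
    using adapted[of n] by (simp add: measurable_restrict_space2_iff)
  then show "Measurable.pred (F n) (\<lambda>\<omega>. Y n \<omega> \<in> U)" for n
    using assms by measurable
qed

lemma stopping_times_ladder_time: "ladder_time Y y \<in> stopping_times M F"
proof (rule stopping_times_INF[OF ladder_time_def])
  have [measurable]: "Y n \<in> borel_measurable (F n)" for n
    using adapted[of n] by (simp add: measurable_restrict_space2_iff)
  show "Measurable.pred (F n) (\<lambda>\<omega>. 0 < n \<and> y < Y n \<omega>)" for n
    by measurable
qed

lemma pred_stopping_times:
  assumes "\<tau> \<in> stopping_times M F"
  shows "Measurable.pred (F n) (\<lambda>\<omega>. \<tau> \<omega> \<le> enat n)" "Measurable.pred (F n) (\<lambda>\<omega>. \<tau> \<omega> = enat n)"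
proof -
  have le: "Measurable.pred (F n) (\<lambda>\<omega>. \<tau> \<omega> \<le> enat n)" for n
    using assms stopping_timeD[of "case_enat F M" \<tau> "enat n"] by (simp add: stopping_times_def)
  then show "Measurable.pred (F n) (\<lambda>\<omega>. \<tau> \<omega> \<le> enat n)" .
  show "Measurable.pred (F n) (\<lambda>\<omega>. \<tau> \<omega> = enat n)"
  proof (cases n)
    case 0
    then show ?thesis using le[of 0] by (simp add: zero_enat_def[symmetric])
  next
    case (Suc k)
    have [measurable]: "Measurable.pred (F n) (\<lambda>\<omega>. \<tau> \<omega> \<le> enat k)"
      by (rule measurable_F_mono[OF _ le]) (simp add: Suc)
    note [measurable] = le[of n]
    have "\<tau> \<omega> = enat n \<longleftrightarrow> \<tau> \<omega> \<le> enat n \<and> \<not> \<tau> \<omega> \<le> enat k" for \<omega>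
      by (cases "\<tau> \<omega>") (auto simp: Suc)
    then show ?thesis by simp
  qed
qed

lemma gain_le_excessive:
  assumes y: "y \<in> E" and \<rho>: "0 \<le> \<rho>" and g: "g \<in> borel_measurable borel"
    and W: "W \<in> borel_measurable S" and gW: "\<And>x. x \<in> E \<Longrightarrow> ennreal (g x) \<le> W x"
    and excessive: "\<And>x. x \<in> E \<Longrightarrow> ennreal \<rho> * (\<integral>\<^sup>+x'. W x' \<partial>K x) \<le> W x"
    and \<tau>: "\<tau> \<in> stopping_times M F"
  shows "gain P Y \<rho> g \<tau> y \<le> W y"
proof -
  have mP: "X \<in> P y \<rightarrow>\<^sub>M N" if "X \<in> F k \<rightarrow>\<^sub>M N" for X k and N :: "'c measure"
    using measurable_F_P[OF y that] .
  note [measurable] = mP[OF pred_stopping_times(1)[OF \<tau>]] mP[OF pred_stopping_times(2)[OF \<tau>]]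
  have [measurable]: "(\<lambda>\<omega>. g (Y n \<omega>)) \<in> borel_measurable (P y)" for n
    by (rule mP[of _ n], rule borel_measurable_S_compose[OF g adapted])
  have WY: "(\<lambda>\<omega>. W (Y n \<omega>)) \<in> borel_measurable (F n)" for n
    using measurable_compose[OF adapted W] .
  note [measurable] = mP[OF WY]
  have KW: "(\<lambda>\<omega>. \<integral>\<^sup>+x. W x \<partial>K (Y n \<omega>)) \<in> borel_measurable (P y)" for n
    by (rule mP[of _ n], rule borel_measurable_K) (use W in auto)
  note [measurable] = KW
  define u where "u = (\<lambda>n \<omega>. if \<tau> \<omega> = enat n then ennreal (\<rho> ^ n * g (Y n \<omega>)) else 0)"
  have [measurable]: "u n \<in> borel_measurable (P y)" for n
    unfolding u_def by measurable
  have "ennreal (discount \<rho> (\<tau> \<omega>) * stopped_value g Y \<tau> \<omega>) = (\<Sum>n. u n \<omega>)" for \<omega>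
  proof (cases "\<tau> \<omega>")
    case (enat k)
    then have "u n \<omega> = (if n = k then ennreal (\<rho> ^ n * g (Y n \<omega>)) else 0)" for n
      by (auto simp: u_def)
    then show ?thesis
      by (simp add: enat discount_def stopped_value_def sums_unique[OF sums_single, symmetric])
  qed (simp add: u_def discount_def)
  then have "gain P Y \<rho> g \<tau> y = (\<Sum>n. \<integral>\<^sup>+\<omega>. u n \<omega> \<partial>P y)"
    unfolding gain_def by (simp add: nn_integral_suminf)
  also have "\<dots> \<le> W y"
    unfolding suminf_eq_SUP
  proof (rule SUP_least)
    fix N
    have "(\<Sum>n<N. \<integral>\<^sup>+\<omega>. u n \<omega> \<partial>P y)
      + (\<integral>\<^sup>+\<omega>. (if enat N \<le> \<tau> \<omega> then ennreal (\<rho> ^ N) else 0) * W (Y N \<omega>) \<partial>P y) \<le> W y"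
    proof (induction N)
      case 0
      show ?case by (simp add: nn_integral_Y0[OF y] flip: zero_enat_def)
    next
      case (Suc N)
      define v where "v = (\<lambda>\<omega>. if \<tau> \<omega> \<le> enat N then 0 else ennreal (\<rho> ^ N))"
      have v [measurable]: "v \<in> borel_measurable (F N)"
        unfolding v_def using pred_stopping_times(1)[OF \<tau>] by measurable
      note [measurable] = mP[OF v]
      have wv: "(if enat (Suc N) \<le> \<tau> \<omega> then ennreal (\<rho> ^ Suc N) else 0) = v \<omega> * ennreal \<rho>" for \<omega>
        using \<rho> by (cases "\<tau> \<omega>") (auto simp: v_def ennreal_mult mult.commute)
      have "(\<integral>\<^sup>+\<omega>. (if enat (Suc N) \<le> \<tau> \<omega> then ennreal (\<rho> ^ Suc N) else 0) * W (Y (Suc N) \<omega>) \<partial>P y) =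
          (\<integral>\<^sup>+\<omega>. \<integral>\<^sup>+x. v \<omega> * ennreal \<rho> * W x \<partial>K (Y N \<omega>) \<partial>P y)"
        unfolding wv by (rule nn_integral_markov[OF y]) (use W in measurable)
      also have "\<dots> = (\<integral>\<^sup>+\<omega>. v \<omega> * (ennreal \<rho> * (\<integral>\<^sup>+x. W x \<partial>K (Y N \<omega>))) \<partial>P y)"
        by (subst nn_integral_cmult)
           (auto simp: mult.assoc measurable_cong_sets[OF sets_K refl] W)
      finally have "(\<integral>\<^sup>+\<omega>. u N \<omega> \<partial>P y)
          + (\<integral>\<^sup>+\<omega>. (if enat (Suc N) \<le> \<tau> \<omega> then ennreal (\<rho> ^ Suc N) else 0) * W (Y (Suc N) \<omega>) \<partial>P y) =
          (\<integral>\<^sup>+\<omega>. u N \<omega> + v \<omega> * (ennreal \<rho> * (\<integral>\<^sup>+x. W x \<partial>K (Y N \<omega>))) \<partial>P y)"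
        by (subst nn_integral_add) auto
      also have "\<dots> \<le> (\<integral>\<^sup>+\<omega>. (if enat N \<le> \<tau> \<omega> then ennreal (\<rho> ^ N) else 0) * W (Y N \<omega>) \<partial>P y)"
      proof (rule nn_integral_mono)
        fix \<omega> assume "\<omega> \<in> space (P y)"
        then have YE: "Y N \<omega> \<in> E" using Y_in_E space_P[OF y] by auto
        consider "\<tau> \<omega> = enat N" | "\<tau> \<omega> < enat N" | "enat N < \<tau> \<omega>"
          by (metis linorder_neqE)
        then show "u N \<omega> + v \<omega> * (ennreal \<rho> * (\<integral>\<^sup>+x. W x \<partial>K (Y N \<omega>)))
          \<le> (if enat N \<le> \<tau> \<omega> then ennreal (\<rho> ^ N) else 0) * W (Y N \<omega>)"
        proof cases
          case 1
          then show ?thesis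
            using \<rho> gW[OF YE] by (auto simp: u_def v_def ennreal_mult' intro: mult_left_mono)
        next
          case 2
          then show ?thesis by (auto simp: u_def v_def)
        next
          case 3
          then have "\<tau> \<omega> \<noteq> enat N" "\<not> \<tau> \<omega> \<le> enat N" by auto
          then show ?thesis
            using 3 excessive[OF YE] by (auto simp: u_def v_def intro: mult_left_mono)
        qed
      qed
      finally show ?case
        using Suc.IH by (simp add: add.assoc) (meson add_left_mono order_trans)
    qed
    then show "(\<Sum>n<N. \<integral>\<^sup>+\<omega>. u n \<omega> \<partial>P y) \<le> W y"
      by (meson add_increasing2 order_refl order_trans zero_le)
  qed
  finally show ?thesis .
qed

section \<open>Optimality of entry times\<close>

lemma optimal_entry_time:
  assumes \<rho>: "0 \<le> \<rho>" "\<rho> \<le> 1" and g: "g \<in> borel_measurable borel"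
    and fin: "\<And>y. y \<in> E \<Longrightarrow> (\<integral>\<^sup>+\<omega>. (SUP n. ennreal (\<rho> ^ n * g (Y n \<omega>))) \<partial>P y) < \<infinity>"
    and lim: "\<And>y. y \<in> E \<Longrightarrow> AE \<omega> in P y. (\<lambda>n. \<rho> ^ n * g (Y n \<omega>)) \<longlonglongrightarrow> 0"
    and U: "U \<in> sets borel" and up: "\<And>x x'. x \<in> U \<Longrightarrow> x \<le> x' \<Longrightarrow> x' \<in> U"
    and below: "\<And>x. x \<in> E \<Longrightarrow> x \<notin> U \<Longrightarrow> ennreal (g x) \<le> gain P Y \<rho> g (ladder_time Y x) x"
    and f0: "\<And>x. x \<in> E \<Longrightarrow> x \<in> U \<Longrightarrow> 0 \<le> f x"
    and f_mono: "\<And>x x'. x \<in> E \<Longrightarrow> x \<in> U \<Longrightarrow> x' \<in> E \<Longrightarrow> x \<le> x' \<Longrightarrow> f x \<le> f x'"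
    and f: "\<And>x. x \<in> E \<Longrightarrow> x \<in> U \<Longrightarrow> ennreal (g x) + ennreal (f x) * gain P Y \<rho> (\<lambda>_. 1) (ladder_time Y x) x
      = ennreal (f x) + gain P Y \<rho> g (ladder_time Y x) x"
  shows "optimal_stopping_time M F E P Y \<rho> g (entry_time Y U)"
proof -
  define W where "W = hit \<rho> (\<lambda>_. U) g 0"
  define \<Gamma> where "\<Gamma> = hit \<rho> greaterThan g"
  define L where "L = hit \<rho> greaterThan (\<lambda>_. 1)"
  have one: "(\<lambda>_. 1 :: real) \<in> borel_measurable borel" by simp
  have UB: "Measurable.pred (borel \<Otimes>\<^sub>M borel) (\<lambda>(t::real, x). x \<in> U)"
    using U by measurable
  note ladder_g = gain_ladder_time[OF _ \<rho>(1) g, folded \<Gamma>_def]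
  note ladder_1 = gain_ladder_time[OF _ \<rho>(1) one, folded L_def]
  have W_m: "W \<in> borel_measurable S"
    using hit_measurable'[OF UB g, of "\<lambda>_. 0" S "\<lambda>x. x"] by (simp add: W_def)
  have gain_W: "gain P Y \<rho> g (entry_time Y U) y = W y" if "y \<in> E" for y
    unfolding W_def by (rule gain_entry_time[OF that \<rho>(1) U g])
  have L1: "L t x \<le> 1" if "x \<in> E" for t x
    unfolding L_def by (rule hit_one_le[OF pred_greaterThan \<rho> that])
  have KL1: "ennreal \<rho> * (\<integral>\<^sup>+x'. L t x' \<partial>K x) \<le> 1" if x: "x \<in> E" for t x
  proof -
    interpret prob_space "K x" by (rule prob_space_K[OF x])
    have "(\<integral>\<^sup>+x'. L t x' \<partial>K x) \<le> (\<integral>\<^sup>+x'. 1 \<partial>K x)"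
      by (rule nn_integral_mono) (simp add: L1 space_K)
    then show ?thesis
      using \<rho> mult_mono[of "ennreal \<rho>" 1 _ 1] by (simp add: emeasure_space_1 ennreal_le_1)
  qed
  have gW: "ennreal (g x) \<le> W x" if x: "x \<in> E" for x
  proof -
    have "ennreal (g x) + 0 * hit \<rho> (\<lambda>_. U) (\<lambda>_. 1) 0 x \<le> 0 + hit \<rho> (\<lambda>_. U) g 0 x"
      by (rule hit_dominates[OF \<rho> g x fin[OF x] lim[OF x] U])
         (use up below ladder_g in \<open>auto simp: \<Gamma>_def\<close>)
    then show ?thesis by (simp add: W_def)
  qed
  have sum_bound: "(\<Sum>n<N. hit_term \<rho> (\<lambda>_. U) g n 0 z) + ennreal (f x) * L x z \<le> ennreal (f x) + \<Gamma> x z"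
    if x: "x \<in> E" "x \<in> U" and z: "z \<in> E" for N x z
    using z
  proof (induction N arbitrary: z)
    case 0
    then show ?case
      using mult_left_mono[OF L1, of z "ennreal (f x)" x] by (simp add: add_increasing2)
  next
    case (Suc N)
    show ?case
    proof (cases "z \<in> U")
      case True
      have *: "ennreal (g v) + ennreal (f x) * (ennreal \<rho> * (\<integral>\<^sup>+x'. L v x' \<partial>K v))
          \<le> ennreal (f x) + ennreal \<rho> * (\<integral>\<^sup>+x'. \<Gamma> v x' \<partial>K v)" if v: "v \<in> E" "z \<le> v" "v \<notin> {x<..}" for v
      proof -
        have vU: "v \<in> U" using True v up by blast
        have split: "ennreal (f x) = ennreal (f v) + ennreal (f x - f v)"
          using f0[OF v(1) vU] f_mono[OF v(1) vU x(1)] v(3) by (simp flip: ennreal_plus)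
        have "ennreal (g v) + ennreal (f x) * (ennreal \<rho> * (\<integral>\<^sup>+x'. L v x' \<partial>K v)) =
            ennreal (f v) + ennreal \<rho> * (\<integral>\<^sup>+x'. \<Gamma> v x' \<partial>K v)
            + ennreal (f x - f v) * (ennreal \<rho> * (\<integral>\<^sup>+x'. L v x' \<partial>K v))"
          using f[OF v(1) vU] unfolding ladder_g[OF v(1)] ladder_1[OF v(1)] split
          by (simp add: distrib_right flip: add.assoc)
        also have "\<dots> \<le> ennreal (f v) + ennreal \<rho> * (\<integral>\<^sup>+x'. \<Gamma> v x' \<partial>K v) + ennreal (f x - f v)"
          using mult_left_mono[OF KL1[OF v(1)], of "ennreal (f x - f v)" v] by (simp add: add_left_mono)
        finally show ?thesis by (simp add: split ac_simps)
      qed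
      have "ennreal (g z) + ennreal (f x) * hit \<rho> (\<lambda>_. {x<..}) (\<lambda>_. 1) x z \<le> ennreal (f x) + hit \<rho> (\<lambda>_. {x<..}) g x z"
        by (rule hit_dominates[OF \<rho> g Suc.prems fin[OF Suc.prems] lim[OF Suc.prems]])
           (use * in \<open>auto simp: L_def \<Gamma>_def\<close>)
      moreover have "hit_term \<rho> (\<lambda>_. {x<..}) q n x = hit_term \<rho> greaterThan q n x" for q n
        by (induction n) (simp_all cong: if_cong)
      moreover have "(\<Sum>n<Suc N. hit_term \<rho> (\<lambda>_. U) g n 0 z) = ennreal (g z)"
        unfolding sum.lessThan_Suc_shift using True by simp
      ultimately show ?thesis by (simp add: L_def \<Gamma>_def hit_def)
    next
      case False
      then have zx: "z \<notin> {x<..}" using up x(2) by force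
      interpret prob_space "K z" by (rule prob_space_K[OF Suc.prems])
      have L_m: "L x \<in> borel_measurable (K z)" and \<Gamma>_m: "\<Gamma> x \<in> borel_measurable (K z)"
        using hit_measurable'[OF pred_greaterThan one, of "\<lambda>_. x" "K z" "\<lambda>x. x"]
          hit_measurable'[OF pred_greaterThan g, of "\<lambda>_. x" "K z" "\<lambda>x. x"] measurable_ident_K
        by (simp_all add: L_def \<Gamma>_def)
      have s_m: "(\<lambda>x'. \<Sum>n<N. hit_term \<rho> (\<lambda>_. U) g n 0 x') \<in> borel_measurable (K z)"
        by (intro borel_measurable_sum hit_term_measurable'[OF UB g]) (auto intro: measurable_ident_K)
      have "(\<Sum>n<Suc N. hit_term \<rho> (\<lambda>_. U) g n 0 z) + ennreal (f x) * L x z =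
          ennreal \<rho> * (\<integral>\<^sup>+x'. (\<Sum>n<N. hit_term \<rho> (\<lambda>_. U) g n 0 x') + ennreal (f x) * L x x' \<partial>K z)"
        unfolding sum_hit_term_Suc[OF UB g False]
        using hit_not_mem[OF pred_greaterThan one zx, of \<rho>] L_m s_m
        by (simp add: L_def[symmetric] nn_integral_add nn_integral_cmult distrib_left mult.left_commute)
      also have "\<dots> \<le> ennreal \<rho> * (\<integral>\<^sup>+x'. ennreal (f x) + \<Gamma> x x' \<partial>K z)"
        by (intro mult_left_mono nn_integral_mono Suc.IH) (auto simp: space_K)
      also have "\<dots> = ennreal \<rho> * ennreal (f x) + \<Gamma> x z"
        using hit_not_mem[OF pred_greaterThan g zx, of \<rho>] \<Gamma>_m
        by (simp add: \<Gamma>_def[symmetric] nn_integral_add emeasure_space_1 distrib_left)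
      also have "\<dots> \<le> ennreal (f x) + \<Gamma> x z"
        using mult_right_mono[of "ennreal \<rho>" 1 "ennreal (f x)"] \<rho> by (simp add: ennreal_le_1 add_right_mono)
      finally show ?thesis .
    qed
  qed
  have W_bound: "W z + ennreal (f x) * L x z \<le> ennreal (f x) + \<Gamma> x z"
    if x: "x \<in> E" "x \<in> U" and z: "z \<in> E" for x z
  proof (rule LIMSEQ_le_const2)
    show "(\<lambda>N. (\<Sum>n<N. hit_term \<rho> (\<lambda>_. U) g n 0 z) + ennreal (f x) * L x z)
        \<longlonglongrightarrow> W z + ennreal (f x) * L x z"
      unfolding W_def hit_def by (intro tendsto_intros summable_LIMSEQ) simp
  qed (use sum_bound[OF x z] in auto)
  have excessive: "ennreal \<rho> * (\<integral>\<^sup>+x'. W x' \<partial>K x) \<le> W x" if x: "x \<in> E" for x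
  proof (cases "x \<in> U")
    case False
    then show ?thesis
      using hit_not_mem[OF UB g False, of \<rho> 0] by (simp add: W_def)
  next
    case True
    interpret prob_space "K x" by (rule prob_space_K[OF x])
    let ?l = "ennreal (f x) * (ennreal \<rho> * (\<integral>\<^sup>+x'. L x x' \<partial>K x))"
    have L_m: "L x \<in> borel_measurable (K x)" and \<Gamma>_m: "\<Gamma> x \<in> borel_measurable (K x)"
      using hit_measurable'[OF pred_greaterThan one, of "\<lambda>_. x" "K x" "\<lambda>x. x"]
        hit_measurable'[OF pred_greaterThan g, of "\<lambda>_. x" "K x" "\<lambda>x. x"] measurable_ident_K
      by (simp_all add: L_def \<Gamma>_def)
    have W_K: "W \<in> borel_measurable (K x)"
      using W_m by (simp add: measurable_cong_sets[OF sets_K refl])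
    have "ennreal \<rho> * (\<integral>\<^sup>+x'. W x' \<partial>K x) + ?l = ennreal \<rho> * (\<integral>\<^sup>+x'. W x' + ennreal (f x) * L x x' \<partial>K x)"
      using L_m W_K by (simp add: nn_integral_add nn_integral_cmult distrib_left mult.left_commute)
    also have "\<dots> \<le> ennreal \<rho> * (\<integral>\<^sup>+x'. ennreal (f x) + \<Gamma> x x' \<partial>K x)"
      by (intro mult_left_mono nn_integral_mono W_bound x True) (auto simp: space_K)
    also have "\<dots> = ennreal \<rho> * ennreal (f x) + ennreal \<rho> * (\<integral>\<^sup>+x'. \<Gamma> x x' \<partial>K x)"
      using \<Gamma>_m by (simp add: nn_integral_add emeasure_space_1 distrib_left)
    also have "\<dots> \<le> ennreal (f x) + ennreal \<rho> * (\<integral>\<^sup>+x'. \<Gamma> x x' \<partial>K x)"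
      using mult_right_mono[of "ennreal \<rho>" 1 "ennreal (f x)"] \<rho> by (simp add: ennreal_le_1 add_right_mono)
    also have "\<dots> = W x + ?l"
      using f[OF x True] unfolding ladder_g[OF x] ladder_1[OF x] by (simp add: W_def hit_mem True)
    finally have "?l + ennreal \<rho> * (\<integral>\<^sup>+x'. W x' \<partial>K x) \<le> ?l + W x"
      by (simp add: add.commute)
    moreover have "?l \<noteq> \<infinity>"
      using mult_left_mono[OF KL1[OF x, of x], of "ennreal (f x)"] by (auto simp: top_unique)
    ultimately show ?thesis by (simp add: ennreal_add_left_cancel_le)
  qed
  have "value_function M F P Y \<rho> g y = W y" if y: "y \<in> E" for y
    unfolding value_function_def
  proof (rule antisym)
    show "(SUP \<tau>\<in>stopping_times M F. gain P Y \<rho> g \<tau> y) \<le> W y"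
      by (rule SUP_least) (rule gain_le_excessive[OF y \<rho>(1) g W_m gW excessive])
    show "W y \<le> (SUP \<tau>\<in>stopping_times M F. gain P Y \<rho> g \<tau> y)"
      unfolding gain_W[OF y, symmetric] by (rule SUP_upper[OF stopping_times_entry_time[OF U]])
  qed
  then show ?thesis
    unfolding optimal_stopping_time_def by (simp add: stopping_times_entry_time[OF U] gain_W)
qed

lemma gain_finite:
  assumes "(\<integral>\<^sup>+\<omega>. (SUP n. ennreal (\<rho> ^ n * g (Y n \<omega>))) \<partial>P y) < \<infinity>"
  shows "gain P Y \<rho> g \<tau> y < \<infinity>"
proof -
  have "ennreal (discount \<rho> (\<tau> \<omega>) * stopped_value g Y \<tau> \<omega>) \<le> (SUP n. ennreal (\<rho> ^ n * g (Y n \<omega>)))" for \<omega>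
    by (cases "\<tau> \<omega>") (auto simp: discount_def stopped_value_def intro: SUP_upper)
  then have "gain P Y \<rho> g \<tau> y \<le> (\<integral>\<^sup>+\<omega>. (SUP n. ennreal (\<rho> ^ n * g (Y n \<omega>))) \<partial>P y)"
    unfolding gain_def by (intro nn_integral_mono) auto
  from this assms show ?thesis by (rule le_less_trans)
qed

lemma measurable_stopping_times:
  assumes y: "y \<in> E" and \<tau>: "\<tau> \<in> stopping_times M F"
  shows "\<tau> \<in> P y \<rightarrow>\<^sub>M count_space UNIV"
proof -
  have [measurable]: "Measurable.pred (P y) (\<lambda>\<omega>. \<tau> \<omega> = enat n)" for n
    by (rule measurable_F_P[OF y pred_stopping_times(2)[OF \<tau>]])
  have inf: "\<tau> \<omega> = \<infinity> \<longleftrightarrow> (\<forall>n. \<tau> \<omega> \<noteq> enat n)" for \<omega>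
    by (cases "\<tau> \<omega>") auto
  have "Measurable.pred (P y) (\<lambda>\<omega>. \<tau> \<omega> = \<infinity>)"
    unfolding inf by measurable
  then have "Measurable.pred (P y) (\<lambda>\<omega>. \<tau> \<omega> = t)" for t
    by (cases t) simp_all
  then show ?thesis
    by (intro measurable_count_space_eq2_countable[THEN iffD2])
       (auto simp: vimage_def Int_def pred_def conj_commute)
qed

lemma gain_one:
  assumes y: "y \<in> E" and \<rho>: "0 < \<rho>" "\<rho> \<le> 1"
  shows "gain P Y \<rho> (\<lambda>_. 1) (ladder_time Y y) y = ennreal (\<integral>\<omega>. discount \<rho> (ladder_time Y y \<omega>) \<partial>P y)"
proof -
  interpret prob_space "P y" by (rule prob_space_P[OF y])
  note [measurable] = measurable_stopping_times[OF y stopping_times_ladder_time]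
  have d: "0 \<le> discount \<rho> t" "discount \<rho> t \<le> 1" for t
    using \<rho> by (cases t; simp add: discount_def power_le_one)+
  have "discount \<rho> (ladder_time Y y \<omega>) * stopped_value (\<lambda>_. 1) Y (ladder_time Y y) \<omega>
      = discount \<rho> (ladder_time Y y \<omega>)" for \<omega>
    by (cases "ladder_time Y y \<omega>") (auto simp: discount_def stopped_value_def)
  then have "gain P Y \<rho> (\<lambda>_. 1) (ladder_time Y y) y = (\<integral>\<^sup>+\<omega>. ennreal (discount \<rho> (ladder_time Y y \<omega>)) \<partial>P y)"
    by (simp only: gain_def)
  also have "\<dots> = ennreal (\<integral>\<omega>. discount \<rho> (ladder_time Y y \<omega>) \<partial>P y)"
    by (rule nn_integral_eq_integral, rule integrable_const_bound[where B=1]) (auto simp: d)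
  finally show ?thesis .
qed

lemma discount_ladder_less_1:
  assumes y: "y \<in> E" and \<rho>: "0 < \<rho>" "\<rho> \<le> 1"
    and inf: "\<rho> = 1 \<Longrightarrow> measure (P y) {\<omega> \<in> space (P y). ladder_time Y y \<omega> = \<infinity>} > 0"
  shows "(\<integral>\<omega>. discount \<rho> (ladder_time Y y \<omega>) \<partial>P y) < 1"
proof -
  interpret prob_space "P y" by (rule prob_space_P[OF y])
  note [measurable] = measurable_stopping_times[OF y stopping_times_ladder_time]
  show ?thesis
  proof (cases "\<rho> = 1")
    case True
    have "(\<integral>\<omega>. discount \<rho> (ladder_time Y y \<omega>) \<partial>P y) =
        (\<integral>\<omega>. 1 - indicator {\<omega> \<in> space (P y). ladder_time Y y \<omega> = \<infinity>} \<omega> \<partial>P y)"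
    proof (rule Bochner_Integration.integral_cong)
      fix \<omega> assume "\<omega> \<in> space (P y)"
      then show "discount \<rho> (ladder_time Y y \<omega>) = 1 - indicator {\<omega> \<in> space (P y). ladder_time Y y \<omega> = \<infinity>} \<omega>"
        by (cases "ladder_time Y y \<omega>") (auto simp: discount_def True)
    qed simp
    also have "\<dots> = 1 - measure (P y) {\<omega> \<in> space (P y). ladder_time Y y \<omega> = \<infinity>}"
      by (subst Bochner_Integration.integral_diff) (auto simp: prob_space integrable_indicator_iff emeasure_eq_measure)
    finally show ?thesis using inf[OF True] by simp
  next
    case False
    have pos: "0 < ladder_time Y y \<omega>" for \<omega>
      unfolding ladder_time_def INF_enat_eq using LeastI_ex[of "\<lambda>n. 0 < n \<and> y < Y n \<omega>"]
      by (auto simp: zero_enat_def)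
    have d: "discount \<rho> (ladder_time Y y \<omega>) \<le> \<rho>" for \<omega>
    proof (cases "ladder_time Y y \<omega>")
      case (enat n)
      then have "1 \<le> n" using pos[of \<omega>] by (simp add: zero_enat_def)
      then show ?thesis
        using \<rho> power_decreasing[of 1 n \<rho>] by (simp add: discount_def enat)
    qed (use \<rho> in \<open>simp add: discount_def\<close>)
    have "(\<integral>\<omega>. discount \<rho> (ladder_time Y y \<omega>) \<partial>P y) \<le> (\<integral>\<omega>. \<rho> \<partial>P y)"
      by (rule integral_mono') (use d \<rho> in auto)
    then show ?thesis using False \<rho> by (simp add: prob_space)
  qed
qed

end

theorem theorem5p1:
  fixes M :: "'a measure" and F :: "nat \<Rightarrow> 'a measure" and E :: "real set"
    and P :: "real \<Rightarrow> 'a measure" and Y :: "nat \<Rightarrow> 'a \<Rightarrow> real"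
    and \<rho> :: real and g :: "real \<Rightarrow> real" and a :: real
  assumes "real_markov_process M F E P Y"
    and "0 < \<rho>" and "\<rho> \<le> 1"
    and "g \<in> borel_measurable borel" and "\<And>x. 0 \<le> g x"
    and "\<And>y. y \<in> E \<Longrightarrow> (\<integral>\<^sup>+\<omega>. (SUP n. ennreal (\<rho> ^ n * g (Y n \<omega>))) \<partial>P y) < \<infinity>"
    and "\<And>y. y \<in> E \<Longrightarrow> AE \<omega> in P y. (\<lambda>n. \<rho> ^ n * g (Y n \<omega>)) \<longlonglongrightarrow> 0"
    and "\<And>y. \<rho> = 1 \<Longrightarrow> y \<in> E \<Longrightarrow> measure (P y) {\<omega> \<in> space (P y). ladder_time Y y \<omega> = \<infinity>} > 0"
    and "alpha_star E P Y \<rho> g = ereal a" and "a \<in> E"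
    and "mono_on {y \<in> E. a \<le> y} (f_fun P Y \<rho> g)"
  shows "(f_fun P Y \<rho> g a \<ge> 0 \<longrightarrow> optimal_stopping_time M F E P Y \<rho> g (entry_time Y {a..}))
    \<and> (f_fun P Y \<rho> g a \<le> 0 \<longrightarrow> optimal_stopping_time M F E P Y \<rho> g (entry_time Y {a<..}))"
proof -
  interpret real_markov_process M F E P Y by fact
  let ?f = "f_fun P Y \<rho> g" and ?\<phi> = "phi P Y \<rho> g"
  define l where "l = (\<lambda>x. \<integral>\<omega>. discount \<rho> (ladder_time Y x \<omega>) \<partial>P x)"
  have l1: "l x < 1" if "x \<in> E" for x
    unfolding l_def using that assms(2,3,8) by (intro discount_ladder_less_1) auto
  have l0: "0 \<le> l x" for x
    unfolding l_def using assms(2) by (intro Bochner_Integration.integral_nonneg) (auto simp: discount_def split: enat.split)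
  have gain_l: "gain P Y \<rho> (\<lambda>_. 1) (ladder_time Y x) x = ennreal (l x)" if "x \<in> E" for x
    unfolding l_def by (rule gain_one[OF that assms(2,3)])
  have gain_\<phi>: "gain P Y \<rho> g (ladder_time Y x) x = ennreal (?\<phi> x)" if "x \<in> E" for x
    unfolding phi_def using gain_finite[OF assms(6)[OF that]] by simp
  have \<phi>0: "0 \<le> ?\<phi> x" for x
    by (simp add: phi_def)
  have f_eq: "g x - ?\<phi> x = ?f x * (1 - l x)" if "x \<in> E" for x
    using l1[OF that] by (simp add: f_fun_def l_def)
  have f_sign: "0 \<le> ?f x \<longleftrightarrow> ?\<phi> x \<le> g x" "?f x \<le> 0 \<longleftrightarrow> g x \<le> ?\<phi> x" if "x \<in> E" for x
    using f_eq[OF that] l1[OF that] zero_le_mult_iff[of "?f x" "1 - l x"] mult_le_0_iff[of "?f x" "1 - l x"]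
    by auto
  have f_id: "ennreal (g x) + ennreal (?f x) * gain P Y \<rho> (\<lambda>_. 1) (ladder_time Y x) x
      = ennreal (?f x) + gain P Y \<rho> g (ladder_time Y x) x" if "x \<in> E" "0 \<le> ?f x" for x
    using f_eq[OF that(1)] assms(5)[of x] l0[of x] \<phi>0[of x] that(2)
    by (simp add: gain_l[OF that(1)] gain_\<phi>[OF that(1)] algebra_simps flip: ennreal_plus ennreal_mult)
  have below: "g x \<le> ?\<phi> x" if "x \<in> E" "x < a" for x
  proof (rule ccontr)
    assume "\<not> g x \<le> ?\<phi> x"
    then have "alpha_star E P Y \<rho> g \<le> ereal x"
      unfolding alpha_star_def using that by (intro INF_lower) auto
    then show False using assms(9) that by simp
  qed
  have opt: "optimal_stopping_time M F E P Y \<rho> g (entry_time Y U)"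
    if U: "U \<in> sets borel" "\<And>x x'. x \<in> U \<Longrightarrow> x \<le> x' \<Longrightarrow> x' \<in> U" "U \<subseteq> {a..}"
      and neg: "\<And>x. x \<in> E \<Longrightarrow> x \<notin> U \<Longrightarrow> g x \<le> ?\<phi> x" and pos: "\<And>x. x \<in> E \<Longrightarrow> x \<in> U \<Longrightarrow> 0 \<le> ?f x" for U
  proof (rule optimal_entry_time[where f="?f", OF _ assms(3,4,6,7) U(1,2)])
    show "?f x \<le> ?f x'" if "x \<in> E" "x \<in> U" "x' \<in> E" "x \<le> x'" for x x'
      using that U(3) by (intro mono_onD[OF assms(11)]) auto
  qed (use neg pos assms(2) f_id gain_\<phi> in \<open>auto intro: ennreal_leI\<close>)
  show ?thesis
  proof (intro conjI impI)
    assume f: "0 \<le> ?f a"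
    show "optimal_stopping_time M F E P Y \<rho> g (entry_time Y {a..})"
    proof (rule opt)
      show "0 \<le> ?f x" if "x \<in> E" "x \<in> {a..}" for x
        using mono_onD[OF assms(11), of a x] f assms(10) that by auto
    qed (use below in auto)
  next
    assume f: "?f a \<le> 0"
    show "optimal_stopping_time M F E P Y \<rho> g (entry_time Y {a<..})"
    proof (rule opt)
      show "g x \<le> ?\<phi> x" if "x \<in> E" "x \<notin> {a<..}" for x
        using that below[of x] f f_sign(2)[OF assms(10)] by (cases "x = a") auto
      show "0 \<le> ?f x" if "x \<in> E" "x \<in> {a<..}" for x
      proof -
        have "alpha_star E P Y \<rho> g < ereal x" using that assms(9) by simp
        then obtain z where z: "z \<in> E" "?\<phi> z \<le> g z" "z < x"
          unfolding alpha_star_def INF_less_iff by auto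
        have "alpha_star E P Y \<rho> g \<le> ereal z"
          unfolding alpha_star_def using z by (intro INF_lower) auto
        then have "a \<le> z" using assms(9) by simp
        then have "?f z \<le> ?f x"
          using z that by (intro mono_onD[OF assms(11)]) auto
        then show ?thesis using f_sign(1)[OF z(1)] z(2) by simp
      qed
    qed auto
  qed
qed

end
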